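(* Define $V:[a,\infty)\to\mathbb{R}$ by $$V(x)=\begin{cases}\displaystyle \rho-\int_a^x\frac{\lambda-l(u)+\frac12\left(\frac{\mu-r}{\sigma}\right)^2}{e(u)}\,du, & a\le x<d,\\[2mm] 0,& x\ge d.\end{cases}$$ Then $V=U$, where $U$ is the value function of the differential game. Moreover, the feedback control $$\pi^*(x)=\begin{cases}\displaystyle\frac{(\mu-r)e(x)}{\sigma^2\left(\frac12(\frac{\mu-r}{\sigma})^2+\lambda-l(x)\right)},& a\le x<d,\\[2mm] 0,&x\ge d,\end{cases}$$ is optimal for the minimizer in the game, i.e. it attains the value: $\sup_{\psi\in\mathcal{AC}_0[0,\infty),\,T\in[0,\infty)}C(x,\pi^*,\psi,T)=U(x)$.
   Context: **Data.** Fix constants $\mu>r>0$ and $\sigma,M_0,a,\lambda,\rho>0$. Let $e:[a,\infty)\to(-\infty,M_0]$ be Lipschitz. Let $l:[a,\infty)\to[0,\lambda)$ be Lipschitz and non-increasing. Convention: $\inf\emptyset=\infty$. Put $b:=\inf\{x\ge a:e(x)<0\}$ and $$d:=b\wedge\inf\Big\{y>a:\ \rho-\int_a^y\frac{\lambda-l(u)+\frac12(\frac{\mu-r}{\sigma})^2}{e(u)}\,du=0\Big\}.$$ The positive constant $M_1$ is fixed and large enough that $|\pi^*|\le M_1$. **Differential game.** $\Pi$ is the set of Lipschitz functions $\pi:[a,\infty)\to[-M_1,M_1]$. $\mathcal{AC}_0[0,\infty)$ is the set of absolutely continuous $\psi:[0,\infty)\to\mathbb{R}$ with $\psi(0)=0$.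 Given $x\ge a$, a feedback control $\pi$ and $\psi\in\mathcal{AC}_0[0,\infty)$, the state process $\varphi$ solves $$\dot\varphi(t)=-e(\varphi(t))+(\mu-r)\pi(\varphi(t))+\sigma\pi(\varphi(t))\dot\psi(t),\qquad\varphi(0)=x,$$ and $\tau$ is the first time $\varphi$ hits $a$ ($\tau=\infty$ if never). Only $\varphi$ up to $\tau$ matters. For $T\in[0,\infty)$ set $$C(x,\pi,\psi,T):=\int_0^{T\wedge\tau}\big[-\lambda+l(\varphi(t))-\tfrac12\dot\psi^2(t)\big]dt+\rho1_{\{\tau\le T\}}.$$ The value of the game is $$U(x):=\inf_{\pi\in\Pi}\ \sup_{\psi\in\mathcal{AC}_0[0,\infty),\,T\in[0,\infty)}C(x,\pi,\psi,T).$$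
   Formalization: V=U is proved if e(a)>0, or if x>a and x≥d. Otherwise it fails or is undefined: if b=a then V(a)=0 but U(a)=ρ; if e(a)=0<b−a, the integral defining V diverges for a<x<d. Optimality of π* is proved for all x≥a. *)

theory Defs
  imports "HOL-Analysis.Analysis"
begin

definition abs_cont_on :: "real \<Rightarrow> real \<Rightarrow> (real \<Rightarrow> real) \<Rightarrow> bool" where
  "abs_cont_on s t f \<longleftrightarrow>
     (\<forall>\<epsilon>>0. \<exists>\<delta>>0. \<forall>D. D division_of \<Union>D \<and> \<Union>D \<subseteq> {s..t} \<and> (\<Sum>k\<in>D. Sup k - Inf k) < \<delta>
        \<longrightarrow> (\<Sum>k\<in>D. \<bar>f (Sup k) - f (Inf k)\<bar>) < \<epsilon>)"

(* On an unbounded half-line absolute continuity means absolute continuity on compact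
   subintervals. Functions on [0,\<infinity>) or [a,\<infinity>) are total functions here; only their values on
   the half-line are ever constrained or used. *)

definition abs_cont_halfline :: "(real \<Rightarrow> real) \<Rightarrow> bool" where
  "abs_cont_halfline f \<longleftrightarrow> (\<forall>t\<ge>0. abs_cont_on 0 t f)"

definition AC0 :: "(real \<Rightarrow> real) set" where
  "AC0 = {\<psi>. abs_cont_halfline \<psi> \<and> \<psi> 0 = 0}"

definition lipschitz_from :: "real \<Rightarrow> (real \<Rightarrow> real) \<Rightarrow> bool" where
  "lipschitz_from a f \<longleftrightarrow> (\<exists>L. L-lipschitz_on {a..} f)"

definition controls :: "real \<Rightarrow> real \<Rightarrow> (real \<Rightarrow> real) set" where
  "controls a M1 = {p. lipschitz_from a p \<and> (\<forall>x\<ge>a. \<bar>p x\<bar> \<le> M1)}"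

definition hit_time :: "real \<Rightarrow> (real \<Rightarrow> real) \<Rightarrow> ereal" where
  "hit_time a \<phi> = (INF t\<in>{t. 0 \<le> t \<and> \<phi> t = a}. ereal t)"

(* Caratheodory solutions. The equation is imposed only before the hitting time of a;
   afterwards the path is an arbitrary absolutely continuous extension, which the cost
   never sees. For x \<ge> a one has \<phi> \<ge> a before the hitting time, by continuity.
   At the points where \<psi> has no derivative, a null set, the value of deriv is irrelevant. *)

definition is_state ::
  "real \<Rightarrow> real \<Rightarrow> real \<Rightarrow> real \<Rightarrow> (real \<Rightarrow> real) \<Rightarrow> real \<Rightarrow> (real \<Rightarrow> real) \<Rightarrow> (real \<Rightarrow> real) \<Rightarrow> (real \<Rightarrow> real) \<Rightarrow> bool"
where
  "is_state \<mu> r \<sigma> a e x p \<psi> \<phi> \<longleftrightarrow>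
     abs_cont_halfline \<phi> \<and> \<phi> 0 = x \<and>
     (AE t in lebesgue. 0 < t \<and> ereal t < hit_time a \<phi> \<longrightarrow>
        (\<phi> has_real_derivative
           (- e (\<phi> t) + (\<mu> - r) * p (\<phi> t) + \<sigma> * p (\<phi> t) * deriv \<psi> t)) (at t))"

(* The running cost -\<lambda> + l - \<psi>'^2/2 is nonpositive, so its integral is written as minus a
   nonnegative integral; this gives -\<infinity>, and not a default value, when \<psi>' is not square
   integrable. *)

definition path_cost ::
  "real \<Rightarrow> real \<Rightarrow> real \<Rightarrow> (real \<Rightarrow> real) \<Rightarrow> (real \<Rightarrow> real) \<Rightarrow> (real \<Rightarrow> real) \<Rightarrow> real \<Rightarrow> ereal"
where
  "path_cost a lam \<rho> l \<psi> \<phi> T =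
     ereal (if hit_time a \<phi> \<le> ereal T then \<rho> else 0)
     - enn2ereal (\<integral>\<^sup>+ t \<in> {t. 0 \<le> t \<and> ereal t \<le> min (ereal T) (hit_time a \<phi>)}.
         ennreal (lam - l (\<phi> t) + (deriv \<psi> t)\<^sup>2 / 2) \<partial>lebesgue)"

(* For Lipschitz p the state process is unique up to the hitting time, and the supremum
   over \<phi> is the cost of that single path. For a discontinuous feedback it ranges over all
   solutions; a \<psi> for which there is none is not available to the maximizer (C = -\<infinity>). *)

definition game_cost ::
  "real \<Rightarrow> real \<Rightarrow> real \<Rightarrow> real \<Rightarrow> real \<Rightarrow> real \<Rightarrow> (real \<Rightarrow> real) \<Rightarrow> (real \<Rightarrow> real)
    \<Rightarrow> real \<Rightarrow> (real \<Rightarrow> real) \<Rightarrow> (real \<Rightarrow> real) \<Rightarrow> real \<Rightarrow> ereal"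
where
  "game_cost \<mu> r \<sigma> a lam \<rho> e l x p \<psi> T =
     (SUP \<phi> \<in> {\<phi>. is_state \<mu> r \<sigma> a e x p \<psi> \<phi>}. path_cost a lam \<rho> l \<psi> \<phi> T)"

definition worst_cost ::
  "real \<Rightarrow> real \<Rightarrow> real \<Rightarrow> real \<Rightarrow> real \<Rightarrow> real \<Rightarrow> (real \<Rightarrow> real) \<Rightarrow> (real \<Rightarrow> real)
    \<Rightarrow> real \<Rightarrow> (real \<Rightarrow> real) \<Rightarrow> ereal"
where
  "worst_cost \<mu> r \<sigma> a lam \<rho> e l x p =
     (SUP (\<psi>, T) \<in> AC0 \<times> {0..}. game_cost \<mu> r \<sigma> a lam \<rho> e l x p \<psi> T)"

definition game_value ::
  "real \<Rightarrow> real \<Rightarrow> real \<Rightarrow> real \<Rightarrow> real \<Rightarrow> real \<Rightarrow> real \<Rightarrow> (real \<Rightarrow> real) \<Rightarrow> (real \<Rightarrow> real)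
    \<Rightarrow> real \<Rightarrow> ereal"
where
  "game_value \<mu> r \<sigma> M1 a lam \<rho> e l x =
     (INF p \<in> controls a M1. worst_cost \<mu> r \<sigma> a lam \<rho> e l x p)"

definition V_formula ::
  "real \<Rightarrow> real \<Rightarrow> real \<Rightarrow> real \<Rightarrow> real \<Rightarrow> real \<Rightarrow> (real \<Rightarrow> real) \<Rightarrow> (real \<Rightarrow> real) \<Rightarrow> real \<Rightarrow> real"
where
  "V_formula \<mu> r \<sigma> a lam \<rho> e l y =
     \<rho> - integral {a..y} (\<lambda>u. (lam - l u + ((\<mu> - r) / \<sigma>)\<^sup>2 / 2) / e u)"

definition b_level :: "real \<Rightarrow> (real \<Rightarrow> real) \<Rightarrow> ereal" where
  "b_level a e = (INF x\<in>{x. a \<le> x \<and> e x < 0}. ereal x)"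

(* Where the integral diverges, integral returns 0; such y do not enter the set because \<rho> > 0. *)

definition d_level ::
  "real \<Rightarrow> real \<Rightarrow> real \<Rightarrow> real \<Rightarrow> real \<Rightarrow> real \<Rightarrow> (real \<Rightarrow> real) \<Rightarrow> (real \<Rightarrow> real) \<Rightarrow> ereal"
where
  "d_level \<mu> r \<sigma> a lam \<rho> e l =
     min (b_level a e) (INF y\<in>{y. a < y \<and> V_formula \<mu> r \<sigma> a lam \<rho> e l y = 0}. ereal y)"

definition V_fun ::
  "real \<Rightarrow> real \<Rightarrow> real \<Rightarrow> real \<Rightarrow> real \<Rightarrow> real \<Rightarrow> (real \<Rightarrow> real) \<Rightarrow> (real \<Rightarrow> real) \<Rightarrow> real \<Rightarrow> real"
where
  "V_fun \<mu> r \<sigma> a lam \<rho> e l x =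
     (if ereal x < d_level \<mu> r \<sigma> a lam \<rho> e l then V_formula \<mu> r \<sigma> a lam \<rho> e l x else 0)"

definition pi_star ::
  "real \<Rightarrow> real \<Rightarrow> real \<Rightarrow> real \<Rightarrow> real \<Rightarrow> real \<Rightarrow> (real \<Rightarrow> real) \<Rightarrow> (real \<Rightarrow> real) \<Rightarrow> real \<Rightarrow> real"
where
  "pi_star \<mu> r \<sigma> a lam \<rho> e l x =
     (if ereal x < d_level \<mu> r \<sigma> a lam \<rho> e l
      then (\<mu> - r) * e x / (\<sigma>\<^sup>2 * (((\<mu> - r) / \<sigma>)\<^sup>2 / 2 + lam - l x)) else 0)"

end

theory Submission
  imports Defs
begin

text \<open>
  Put \<open>\<beta> = (\<mu> - r) / \<sigma>\<close> and \<open>\<kappa> = lam - l + \<beta>\<^sup>2 / 2\<close>, so that \<open>V' = - \<kappa> / e\<close> below \<open>d\<close>.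

  Lower bound. Against every control the maximizer may play \<open>\<psi> t = - \<beta> * t\<close>: the terms with the
  control cancel and the state moves by \<open>\<phi>' = - e \<phi>\<close>. For \<open>x < d\<close> it reaches \<open>a\<close>, and the cost of
  the path is exactly \<open>V x\<close>; stopping at time 0 gives 0 for every \<open>x > a\<close>.

  Upper bound, \<open>0 < e a\<close>. Where the control is the optimal one, the derivative of \<open>V \<circ> \<phi>\<close> is
  \<open>lam - l \<phi> - \<beta>\<^sup>2 / 2 - \<beta> * \<psi>'\<close>, which is at most the running cost \<open>lam - l \<phi> + \<psi>'\<^sup>2 / 2\<close>. Since
  \<open>V\<close> vanishes at \<open>d\<close>, it suffices to use this after the last time the path is at or above \<open>d\<close>.

  Upper bound, \<open>e a \<le> 0\<close>. The zero control and the optimal one vanish at \<open>a\<close> at least linearly,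
  and a path driven by such a control does not reach \<open>a\<close> at finite cost.
\<close>

section \<open>Absolutely continuous functions\<close>

lemma division_of_reals_memD:
  fixes D :: "real set set"
  assumes "D division_of \<Union>D" "\<Union>D \<subseteq> {s..t}" "k \<in> D"
  obtains c d where "k = {c..d}" "c \<le> d" "Inf k = c" "Sup k = d" "c \<in> {s..t}" "d \<in> {s..t}"
proof -
  obtain c d where k: "k = cbox c d" "k \<noteq> {}"
    using division_ofD(3,4)[OF assms(1,3)] by blast
  then have "c \<le> d" by auto
  moreover have "c \<in> k" "d \<in> k" using k \<open>c \<le> d\<close> by auto
  moreover have "k \<subseteq> {s..t}" using assms(2,3) by blast
  ultimately show ?thesis
    using k that[of c d] by auto
qed

lemma abs_cont_onE:
  assumes "abs_cont_on s t f" "0 < \<epsilon>"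
  obtains \<delta> where "0 < \<delta>"
    "\<And>D. D division_of \<Union>D \<Longrightarrow> \<Union>D \<subseteq> {s..t} \<Longrightarrow> (\<Sum>k\<in>D. Sup k - Inf k) < \<delta>
        \<Longrightarrow> (\<Sum>k\<in>D. \<bar>f (Sup k) - f (Inf k)\<bar>) < \<epsilon>"
proof -
  obtain \<delta> where "0 < \<delta>"
    "\<forall>D. D division_of \<Union>D \<and> \<Union>D \<subseteq> {s..t} \<and> (\<Sum>k\<in>D. Sup k - Inf k) < \<delta>
        \<longrightarrow> (\<Sum>k\<in>D. \<bar>f (Sup k) - f (Inf k)\<bar>) < \<epsilon>"
    using assms(1)[unfolded abs_cont_on_def, rule_format, OF assms(2)] by blast
  then show ?thesis using that by blast
qed

lemma abs_cont_on_subset: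
  assumes "abs_cont_on s t f" "{s'..t'} \<subseteq> {s..t}"
  shows "abs_cont_on s' t' f"
  unfolding abs_cont_on_def
proof (intro allI impI)
  fix \<epsilon> :: real assume "0 < \<epsilon>"
  then obtain \<delta> where "0 < \<delta>"
    "\<And>D. D division_of \<Union>D \<Longrightarrow> \<Union>D \<subseteq> {s..t} \<Longrightarrow> (\<Sum>k\<in>D. Sup k - Inf k) < \<delta>
        \<Longrightarrow> (\<Sum>k\<in>D. \<bar>f (Sup k) - f (Inf k)\<bar>) < \<epsilon>"
    using abs_cont_onE[OF assms(1) \<open>0 < \<epsilon>\<close>] by blast
  then show "\<exists>\<delta>>0. \<forall>D. D division_of \<Union>D \<and> \<Union>D \<subseteq> {s'..t'} \<and> (\<Sum>k\<in>D. Sup k - Inf k) < \<delta>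
        \<longrightarrow> (\<Sum>k\<in>D. \<bar>f (Sup k) - f (Inf k)\<bar>) < \<epsilon>"
    using assms(2) by (intro exI[of _ \<delta>]) (meson order_trans)
qed

lemma abs_cont_on_id: "abs_cont_on s t (\<lambda>x. x)"
  unfolding abs_cont_on_def
proof (intro allI impI)
  fix \<epsilon> :: real assume "0 < \<epsilon>"
  moreover have "(\<Sum>k\<in>D. \<bar>Sup k - Inf k\<bar>) = (\<Sum>k\<in>D. Sup k - Inf k)"
    if D: "D division_of \<Union>D" "\<Union>D \<subseteq> {s..t}" for D :: "real set set"
  proof (rule sum.cong[OF refl])
    fix k assume "k \<in> D"
    then obtain c d where "c \<le> d" "Inf k = c" "Sup k = d"
      using division_of_reals_memD[OF D] by metis
    then show "\<bar>Sup k - Inf k\<bar> = Sup k - Inf k" by simp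
  qed
  ultimately show "\<exists>\<delta>>0. \<forall>D. D division_of \<Union>D \<and> \<Union>D \<subseteq> {s..t} \<and> (\<Sum>k\<in>D. Sup k - Inf k) < \<delta>
        \<longrightarrow> (\<Sum>k\<in>D. \<bar>Sup k - Inf k\<bar>) < \<epsilon>"
    by (intro exI[of _ \<epsilon>]) auto
qed

lemma abs_cont_on_lipschitz_compose:
  assumes f: "abs_cont_on s t f" and g: "L-lipschitz_on X g" and fX: "f ` {s..t} \<subseteq> X"
  shows "abs_cont_on s t (\<lambda>u. g (f u))"
  unfolding abs_cont_on_def
proof (intro allI impI)
  fix \<epsilon> :: real assume "0 < \<epsilon>"
  have L: "0 \<le> L" using g by (rule lipschitz_on_nonneg)
  \<comment> \<open>Dividing by \<open>L + 1\<close> instead of \<open>L\<close> covers the case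
    \<open>L = 0\<close>.\<close>
  have "0 < \<epsilon> / (L + 1)" using \<open>0 < \<epsilon>\<close> L by simp
  then obtain \<delta> where \<delta>: "0 < \<delta>"
    "\<And>D. D division_of \<Union>D \<Longrightarrow> \<Union>D \<subseteq> {s..t} \<Longrightarrow> (\<Sum>k\<in>D. Sup k - Inf k) < \<delta>
        \<Longrightarrow> (\<Sum>k\<in>D. \<bar>f (Sup k) - f (Inf k)\<bar>) < \<epsilon> / (L + 1)"
    using abs_cont_onE[OF f \<open>0 < \<epsilon> / (L + 1)\<close>] by blast
  have "(\<Sum>k\<in>D. \<bar>g (f (Sup k)) - g (f (Inf k))\<bar>) < \<epsilon>"
    if D: "D division_of \<Union>D" "\<Union>D \<subseteq> {s..t}" and len: "(\<Sum>k\<in>D. Sup k - Inf k) < \<delta>" for D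
  proof -
    have "(\<Sum>k\<in>D. \<bar>g (f (Sup k)) - g (f (Inf k))\<bar>) \<le> (\<Sum>k\<in>D. (L + 1) * \<bar>f (Sup k) - f (Inf k)\<bar>)"
    proof (rule sum_mono)
      fix k assume "k \<in> D"
      then obtain c d where "Inf k = c" "Sup k = d" "c \<in> {s..t}" "d \<in> {s..t}"
        using division_of_reals_memD[OF D] by metis
      then have "\<bar>g (f (Sup k)) - g (f (Inf k))\<bar> \<le> L * \<bar>f (Sup k) - f (Inf k)\<bar>"
        using lipschitz_onD[OF g, of "f d" "f c"] image_subset_iff[THEN iffD1, OF fX]
        by (simp add: dist_real_def)
      also have "\<dots> \<le> (L + 1) * \<bar>f (Sup k) - f (Inf k)\<bar>"
        by (intro mult_right_mono) auto
      finally show "\<bar>g (f (Sup k)) - g (f (Inf k))\<bar> \<le> (L + 1) * \<bar>f (Sup k) - f (Inf k)\<bar>" .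
    qed
    also have "\<dots> = (L + 1) * (\<Sum>k\<in>D. \<bar>f (Sup k) - f (Inf k)\<bar>)"
      by (simp add: sum_distrib_left)
    also have "\<dots> < (L + 1) * (\<epsilon> / (L + 1))"
      using \<delta>(2)[OF D len] L by (intro mult_strict_left_mono) auto
    also have "\<dots> = \<epsilon>" using L by simp
    finally show ?thesis .
  qed
  then show "\<exists>\<delta>>0. \<forall>D. D division_of \<Union>D \<and> \<Union>D \<subseteq> {s..t} \<and> (\<Sum>k\<in>D. Sup k - Inf k) < \<delta>
        \<longrightarrow> (\<Sum>k\<in>D. \<bar>g (f (Sup k)) - g (f (Inf k))\<bar>) < \<epsilon>"
    using \<delta>(1) by blast
qed

lemma lipschitz_imp_abs_cont_on: "L-lipschitz_on {s..t} f \<Longrightarrow> abs_cont_on s t f"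
  using abs_cont_on_lipschitz_compose[OF abs_cont_on_id] by fastforce

lemma abs_cont_on_imp_continuous_on:
  assumes "abs_cont_on s t f"
  shows "continuous_on {s..t} f"
  unfolding continuous_on_iff
proof (intro ballI allI impI)
  fix x \<epsilon> :: real assume x: "x \<in> {s..t}" and "0 < \<epsilon>"
  then obtain \<delta> where \<delta>: "0 < \<delta>"
    "\<And>D. D division_of \<Union>D \<Longrightarrow> \<Union>D \<subseteq> {s..t} \<Longrightarrow> (\<Sum>k\<in>D. Sup k - Inf k) < \<delta>
        \<Longrightarrow> (\<Sum>k\<in>D. \<bar>f (Sup k) - f (Inf k)\<bar>) < \<epsilon>"
    using abs_cont_onE[OF assms \<open>0 < \<epsilon>\<close>] by blast
  \<comment> \<open>Absolute continuity is applied to a division with one single cell.\<close>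
  have *: "\<bar>f d - f c\<bar> < \<epsilon>" if "c \<le> d" "c \<in> {s..t}" "d \<in> {s..t}" "d - c < \<delta>" for c d
  proof -
    have "{{c..d}} division_of \<Union>{{c..d}}"
      using division_of_self[of c d] that by auto
    with \<delta>(2)[of "{{c..d}}"] that show ?thesis by auto
  qed
  have "dist (f y) (f x) < \<epsilon>" if "y \<in> {s..t}" "dist y x < \<delta>" for y
    using *[of x y] *[of y x] x that by (cases x y rule: linorder_cases) (auto simp: dist_real_def \<open>0 < \<epsilon>\<close>)
  then show "\<exists>\<delta>>0. \<forall>y\<in>{s..t}. dist y x < \<delta> \<longrightarrow> dist (f y) (f x) < \<epsilon>"
    using \<delta>(1) by blast
qed

text \<open>On the exceptional null set the Riemann sums are controlled by absolute continuity, because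
  the intervals tagged there can be forced into an open set of small measure.\<close>

lemma abs_cont_on_has_integral:
  fixes f D :: "real \<Rightarrow> real"
  assumes st: "s \<le> t" and ac: "abs_cont_on s t f" and N: "negligible N"
    and der: "\<And>u. u \<in> {s..t} - N \<Longrightarrow> (f has_real_derivative D u) (at u within {s..t})"
  shows "(D has_integral (f t - f s)) {s..t}"
proof -
  \<comment> \<open>The values of \<open>D\<close> on \<open>N\<close> are arbitrary. With 0 in
    their place, a cell tagged in \<open>N\<close> contributes only its increment of
    \<open>f\<close> to the error.\<close>
  define D' where "D' u = (if u \<in> N then 0 else D u)" for u
  have "(D' has_integral (f t - f s)) {s..t}"
    unfolding has_integral_real
  proof (intro allI impI)
    fix \<epsilon> :: real assume \<epsilon>: "0 < \<epsilon>"
    obtain \<delta> where \<delta>: "0 < \<delta>"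
      "\<And>E. E division_of \<Union>E \<Longrightarrow> \<Union>E \<subseteq> {s..t} \<Longrightarrow> (\<Sum>k\<in>E. Sup k - Inf k) < \<delta>
          \<Longrightarrow> (\<Sum>k\<in>E. \<bar>f (Sup k) - f (Inf k)\<bar>) < \<epsilon> / 2"
      using abs_cont_onE[OF ac half_gt_zero[OF \<epsilon>]] by blast
    obtain U where U: "open U" "N \<subseteq> U" "U \<in> lmeasurable" "measure lebesgue U < \<delta>"
    proof -
      obtain U where U: "open U" "N \<subseteq> U" "(U - N) \<in> lmeasurable"
          "emeasure lebesgue (U - N) < ennreal \<delta>"
        using sets_lebesgue_outer_open[OF negligible_imp_sets[OF N] \<delta>(1)] by blast
      have UN: "U = (U - N) \<union> N" using U(2) by blast
      have "U \<in> lmeasurable"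
        using UN U(3) negligible_imp_measurable[OF N] by (metis fmeasurable.Un)
      moreover have "measure lebesgue (U - N \<union> N) = measure lebesgue (U - N)"
        by (rule measure_Un_null_set) (use U(3) N in \<open>auto simp: negligible_iff_null_sets\<close>)
      then have "measure lebesgue U = measure lebesgue (U - N)"
        by (simp only: UN[symmetric])
      moreover have "measure lebesgue (U - N) < \<delta>"
        using U(4) by (simp add: emeasure_eq_measure2[OF U(3)] ennreal_less_iff)
      ultimately show ?thesis by (intro that[OF U(1,2)]) auto
    qed
    \<comment> \<open>An error of \<eta> per unit length adds up to at most half of \<epsilon>; the
      \<open>+ 1\<close> covers \<open>s = t\<close>.\<close>
    define \<eta> where "\<eta> = \<epsilon> / (2 * (t - s + 1))"
    have \<eta>: "0 < \<eta>" using \<epsilon> st by (simp add: \<eta>_def)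
    \<comment> \<open>The radius of the gauge comes from differentiability off \<open>N\<close>, and
      on \<open>N\<close> it keeps the cells inside \<open>U\<close>.\<close>
    have "\<exists>d>0. (u \<in> {s..t} - N \<longrightarrow>
         (\<forall>y\<in>{s..t}. norm (y-u) < d \<longrightarrow> norm (f y - f u - (y-u) * D u) \<le> \<eta> * norm (y-u)))
         \<and> (u \<in> N \<longrightarrow> ball u d \<subseteq> U)" for u
    proof (cases "u \<in> N")
      case True
      then show ?thesis using U(1,2) open_contains_ball by blast
    next
      case False
      show ?thesis
      proof (cases "u \<in> {s..t}")
        case True
        with False have "(f has_real_derivative D u) (at u within {s..t})" using der by blast
        then show ?thesis
          using False \<eta> unfolding has_field_derivative_def has_derivative_within_alt
          by (auto simp: mult.commute)
      qed (use False in \<open>auto intro: exI[of _ 1]\<close>)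
    qed
    then obtain d where d: "\<And>u. 0 < d u"
      "\<And>u y. u \<in> {s..t} - N \<Longrightarrow> y \<in> {s..t} \<Longrightarrow> norm (y-u) < d u \<Longrightarrow>
           norm (f y - f u - (y-u) * D u) \<le> \<eta> * norm (y-u)"
      "\<And>u. u \<in> N \<Longrightarrow> ball u (d u) \<subseteq> U"
      by metis
    show "\<exists>\<gamma>. gauge \<gamma> \<and> (\<forall>\<D>. \<D> tagged_division_of {s..t} \<and> \<gamma> fine \<D> \<longrightarrow>
        norm (sum (\<lambda>(x,k). measure lborel k *\<^sub>R D' x) \<D> - (f t - f s)) < \<epsilon>)"
    proof (intro exI conjI allI impI; (elim conjE)?)
      show "gauge (\<lambda>u. ball u (d u))" using d(1) gauge_ball_dependent by blast
    next
      fix p assume p: "p tagged_division_of {s..t}" and fine: "(\<lambda>u. ball u (d u)) fine p"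
      have fin: "finite p" using p by blast
      have mem: "\<exists>c e. k = {c..e} \<and> c \<le> e \<and> Inf k = c \<and> Sup k = e \<and> c \<in> {s..t} \<and> e \<in> {s..t}
            \<and> x \<in> {c..e} \<and> x \<in> {s..t} \<and> k \<subseteq> ball x (d x) \<and> measure lborel k = e - c"
        if xk: "(x, k) \<in> p" for x k
      proof -
        have "x \<in> k" "k \<subseteq> {s..t}" using tagged_division_ofD(2,3)[OF p xk] by auto
        moreover obtain c e where "k = {c..e}" using tagged_division_ofD(4)[OF p xk] by auto
        moreover have "k \<subseteq> ball x (d x)" using fine xk by (auto simp: fine_def)
        ultimately show ?thesis by auto
      qed
      define q where "q = {z \<in> p. fst z \<in> N}"
      have q: "q tagged_partial_division_of {s..t}"
        using p tagged_partial_division_subset[of p "{s..t}" q]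
        by (auto simp: q_def tagged_division_of_def)
      have divq: "snd ` q division_of \<Union>(snd ` q)"
        by (rule partial_division_of_tagged_division[OF q])
      have Uq: "\<Union>(snd ` q) \<subseteq> {s..t}" "\<Union>(snd ` q) \<subseteq> U"
      proof -
        have "k \<subseteq> {s..t} \<and> k \<subseteq> U" if kq: "k \<in> snd ` q" for k
        proof -
          obtain x where x: "(x, k) \<in> p" "x \<in> N" using kq by (auto simp: q_def)
          then show ?thesis
            using tagged_division_ofD(3)[OF p x(1)] mem[OF x(1)] d(3)[OF x(2)] by blast
        qed
        then show "\<Union>(snd ` q) \<subseteq> {s..t}" "\<Union>(snd ` q) \<subseteq> U" by blast+
      qed
      have "(\<Sum>k\<in>snd ` q. Sup k - Inf k) = (\<Sum>k\<in>snd ` q. measure lebesgue k)"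
      proof (rule sum.cong[OF refl])
        fix k assume "k \<in> snd ` q"
        then obtain x where "(x, k) \<in> p" by (auto simp: q_def)
        from mem[OF this] obtain c e where "k = {c..e}" "c \<le> e" by blast
        then show "Sup k - Inf k = measure lebesgue k" by simp
      qed
      also have "\<dots> = measure lebesgue (\<Union>(snd ` q))"
        using content_division[OF divq] by simp
      also have "\<dots> \<le> measure lebesgue U"
        using Uq U(3) lmeasurable_division[OF divq] by (intro measure_mono_fmeasurable) auto
      also have "\<dots> < \<delta>" by (rule U(4))
      finally have "(\<Sum>k\<in>snd ` q. \<bar>f (Sup k) - f (Inf k)\<bar>) < \<epsilon> / 2"
        by (intro \<delta>(2) divq Uq(1))
      \<comment> \<open>Distinct tags share a cell only if the cell is a single point. The increment
        there is 0, so summing over cells and over tagged cells gives the same.\<close>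
      also have "(\<Sum>k\<in>snd ` q. \<bar>f (Sup k) - f (Inf k)\<bar>) = (\<Sum>z\<in>q. \<bar>f (Sup (snd z)) - f (Inf (snd z))\<bar>)"
      proof (subst sum.reindex_nontrivial)
        show "finite q" using fin by (simp add: q_def)
        fix z w assume zw: "z \<in> q" "w \<in> q" "z \<noteq> w" "snd z = snd w"
        obtain x y k where eq: "z = (x, k)" "w = (y, k)" using zw(4) by (metis prod.collapse)
        have "interior k \<inter> interior k = {}"
          using tagged_division_ofD(5)[OF p, of x k y k] zw eq by (auto simp: q_def)
        moreover obtain c e where "k = {c..e}" "c \<le> e" "Inf k = c" "Sup k = e"
          using mem[of x k] zw(1) eq by (auto simp: q_def)
        ultimately show "\<bar>f (Sup (snd z)) - f (Inf (snd z))\<bar> = 0"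
          using eq by (auto simp: interior_atLeastAtMost_real)
      qed (simp add: o_def)
      finally have sumq: "(\<Sum>z\<in>q. \<bar>f (Sup (snd z)) - f (Inf (snd z))\<bar>) < \<epsilon> / 2" .
      have "(\<Sum>(x,k)\<in>p. f (Sup k) - f (Inf k)) = f t - f s"
        using additive_tagged_division_1[OF st p] by simp
      then have "(\<Sum>(x,k)\<in>p. measure lborel k *\<^sub>R D' x) - (f t - f s)
          = (\<Sum>(x,k)\<in>p. measure lborel k *\<^sub>R D' x - (f (Sup k) - f (Inf k)))"
        by (simp add: sum_subtractf case_prod_unfold)
      also have "norm \<dots> \<le> (\<Sum>z\<in>p. \<eta> * measure lborel (snd z) + (if z \<in> q then \<bar>f (Sup (snd z)) - f (Inf (snd z))\<bar> else 0))"
      proof (rule sum_norm_le)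
        fix z assume z: "z \<in> p"
        obtain x k where eq: "z = (x, k)" by force
        obtain c e where k: "k = {c..e}" "c \<le> e" "Inf k = c" "Sup k = e" "c \<in> {s..t}" "e \<in> {s..t}"
            "x \<in> {c..e}" "x \<in> {s..t}" "k \<subseteq> ball x (d x)" "measure lborel k = e - c"
          using mem[of x k] z eq by auto
        show "norm (case z of (x, k) \<Rightarrow> measure lborel k *\<^sub>R D' x - (f (Sup k) - f (Inf k)))
            \<le> \<eta> * measure lborel (snd z) + (if z \<in> q then \<bar>f (Sup (snd z)) - f (Inf (snd z))\<bar> else 0)"
        proof (cases "x \<in> N")
          case True
          moreover have "0 \<le> \<eta> * (e - c)" using \<eta> k(2) by simp
          ultimately show ?thesis using z k eq by (simp add: q_def D'_def abs_minus_commute)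
        next
          case False
          have near: "norm (c - x) < d x" "norm (e - x) < d x"
          proof -
            have "c \<in> ball x (d x)" "e \<in> ball x (d x)" using k(1,2,9) by auto
            then show "norm (c - x) < d x" "norm (e - x) < d x" by (auto simp: dist_real_def)
          qed
          \<comment> \<open>The tag lies between the endpoints, so the two one-sided errors add up
            to \<eta> times the length of the cell.\<close>
          have "\<bar>f c - f x - (c - x) * D x\<bar> \<le> \<eta> * (x - c)" "\<bar>f e - f x - (e - x) * D x\<bar> \<le> \<eta> * (e - x)"
            using d(2)[of x c] d(2)[of x e] False k near by auto
          then have "\<bar>(e - c) * D x - (f e - f c)\<bar> \<le> \<eta> * (e - c)"
            by (simp add: algebra_simps abs_le_iff)
          then show ?thesis using False eq k by (simp add: q_def D'_def)
        qed
      qed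
      also have "\<dots> = \<eta> * (t - s) + (\<Sum>z\<in>q. \<bar>f (Sup (snd z)) - f (Inf (snd z))\<bar>)"
      proof -
        have "(\<Sum>z\<in>p. \<eta> * measure lborel (snd z)) = \<eta> * (t - s)"
          using additive_content_tagged_division[of p s t] p st
          by (simp add: sum_distrib_left[symmetric] case_prod_unfold)
        moreover have "(\<Sum>z\<in>p. if z \<in> q then \<bar>f (Sup (snd z)) - f (Inf (snd z))\<bar> else 0)
            = (\<Sum>z\<in>q. \<bar>f (Sup (snd z)) - f (Inf (snd z))\<bar>)"
          using fin by (subst sum.inter_restrict[symmetric]) (auto simp: q_def intro!: sum.cong)
        ultimately show ?thesis by (simp add: sum.distrib)
      qed
      also have "\<dots> < \<epsilon> / 2 + \<epsilon> / 2"
      proof (rule add_le_less_mono[OF _ sumq])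
        show "\<eta> * (t - s) \<le> \<epsilon> / 2"
          using st \<epsilon> by (simp add: \<eta>_def field_simps)
      qed
      finally show "norm ((\<Sum>(x, k)\<in>p. measure lborel k *\<^sub>R D' x) - (f t - f s)) < \<epsilon>" by simp
    qed
  qed
  then show ?thesis
    by (rule has_integral_spike[OF N, rotated]) (auto simp: D'_def)
qed

section \<open>Growth estimates along absolutely continuous paths\<close>

text \<open>Nothing is known about the measurability of \<open>h\<close>, so the comparison goes
  through the positive part of the derivative. That part is measurable because the derivative is
  gauge integrable, it is bounded by the positive part of \<open>h\<close>, and its integral is at
  least the increment. An infinite right-hand side leaves nothing to prove.\<close>

lemma abs_cont_on_increment_le_nn_integral:
  fixes f h :: "real \<Rightarrow> real"
  assumes st: "s \<le> t" and ac: "abs_cont_on s t f"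
    and der: "AE u in lebesgue. s < u \<and> u < t \<longrightarrow>
        (\<exists>D \<le> h u. (f has_real_derivative D) (at u within {s..t}))"
  shows "ereal (f t - f s) \<le> enn2ereal (\<integral>\<^sup>+u\<in>{s..t}. ennreal (h u) \<partial>lebesgue)"
proof -
  let ?P = "\<lambda>u. s < u \<and> u < t \<longrightarrow> (\<exists>D \<le> h u. (f has_real_derivative D) (at u within {s..t}))"
  obtain N0 where N0: "N0 \<in> null_sets lebesgue" "{u. \<not> ?P u} \<subseteq> N0"
  proof -
    obtain N where "\<And>u. u \<in> space lebesgue - N \<Longrightarrow> ?P u" "N \<in> null_sets lebesgue"
      using der by (rule AE_E3) (rule that)
    then show ?thesis by (intro that[of N]) auto
  qed
  define N where "N = N0 \<union> {s, t}"
  have N: "negligible N"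
    using N0(1) by (auto simp: N_def negligible_iff_null_sets intro!: null_sets.Un)
  have "\<forall>u. \<exists>D. u \<in> {s..t} - N \<longrightarrow> D \<le> h u \<and> (f has_real_derivative D) (at u within {s..t})"
  proof
    fix u
    show "\<exists>D. u \<in> {s..t} - N \<longrightarrow> D \<le> h u \<and> (f has_real_derivative D) (at u within {s..t})"
    proof (cases "u \<in> {s..t} - N")
      case True
      then have "?P u" using N0(2) unfolding N_def by blast
      moreover have "s < u" "u < t" using True by (auto simp: N_def)
      ultimately show ?thesis by blast
    qed blast
  qed
  then obtain D where D: "\<And>u. u \<in> {s..t} - N \<Longrightarrow> D u \<le> h u"
    "\<And>u. u \<in> {s..t} - N \<Longrightarrow> (f has_real_derivative D u) (at u within {s..t})"
    by metis
  have I: "(D has_integral (f t - f s)) {s..t}"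
    by (rule abs_cont_on_has_integral[OF st ac N D(2)])
  define g where "g u = indicator {s..t} u * max 0 (D u)" for u
  have "(\<lambda>u. indicator {s..t} u *\<^sub>R D u) \<in> borel_measurable lebesgue"
    by (rule has_integral_implies_lebesgue_measurable[OF I])
  then have "(\<lambda>u. max 0 (indicator {s..t} u *\<^sub>R D u)) \<in> borel_measurable lebesgue"
    by measurable
  also have "(\<lambda>u. max 0 (indicator {s..t} u *\<^sub>R D u)) = g"
    by (auto simp: g_def indicator_def)
  finally have meas: "g \<in> borel_measurable lebesgue" .
  have g0: "0 \<le> g u" for u by (simp add: g_def)
  have le: "(\<integral>\<^sup>+u. ennreal (g u) \<partial>lebesgue) \<le> (\<integral>\<^sup>+u\<in>{s..t}. ennreal (h u) \<partial>lebesgue)"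
  proof (rule nn_integral_mono_AE)
    have "AE u in lebesgue. u \<notin> N"
      using N by (intro AE_not_in) (simp add: negligible_iff_null_sets)
    then show "AE u in lebesgue. ennreal (g u) \<le> ennreal (h u) * indicator {s..t} u"
    proof eventually_elim
      case (elim u)
      then show ?case using D(1)[of u] by (auto simp: g_def indicator_def max_def ennreal_leI)
    qed
  qed
  show ?thesis
  proof (cases "(\<integral>\<^sup>+u\<in>{s..t}. ennreal (h u) \<partial>lebesgue) = \<infinity>")
    case False
    then have fin: "(\<integral>\<^sup>+u. ennreal (g u) \<partial>lebesgue) < \<infinity>"
      using le by (auto simp: less_top top.not_eq_extremum)
    have int: "integrable lebesgue g"
      using meas g0 fin by (intro integrableI_nonneg) auto
    have "(g has_integral integral\<^sup>L lebesgue g) UNIV"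
      by (rule has_integral_integral_lebesgue[OF int])
    moreover have "g = (\<lambda>u. if u \<in> {s..t} then max 0 (D u) else 0)"
      by (auto simp: g_def indicator_def)
    ultimately have "((\<lambda>u. max 0 (D u)) has_integral integral\<^sup>L lebesgue g) {s..t}"
      using has_integral_restrict_UNIV by metis
    then have "f t - f s \<le> integral\<^sup>L lebesgue g"
      by (rule has_integral_le[OF I]) auto
    then have "ereal (f t - f s) \<le> enn2ereal (ennreal (integral\<^sup>L lebesgue g))"
      by (simp add: enn2ereal_ennreal integral_nonneg_AE g0)
    also have "ennreal (integral\<^sup>L lebesgue g) = (\<integral>\<^sup>+u. ennreal (g u) \<partial>lebesgue)"
      using int g0 by (simp add: nn_integral_eq_integral)
    also have "enn2ereal \<dots> \<le> enn2ereal (\<integral>\<^sup>+u\<in>{s..t}. ennreal (h u) \<partial>lebesgue)"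
      using le by (simp add: less_eq_ennreal.rep_eq)
    finally show ?thesis .
  qed simp
qed

lemma C1_imp_lipschitz_on:
  fixes F F' :: "real \<Rightarrow> real"
  assumes der: "\<And>y. y \<in> {\<alpha>..\<gamma>} \<Longrightarrow> (F has_real_derivative F' y) (at y within {\<alpha>..\<gamma>})"
    and cont: "continuous_on {\<alpha>..\<gamma>} F'"
  obtains L where "L-lipschitz_on {\<alpha>..\<gamma>} F"
proof -
  have "bounded (F' ` {\<alpha>..\<gamma>})"
    by (intro compact_imp_bounded compact_continuous_image cont) simp
  then obtain L where L: "\<forall>y\<in>{\<alpha>..\<gamma>}. \<bar>F' y\<bar> \<le> L"
    by (auto simp: bounded_iff)
  \<comment> \<open>On an empty interval \<open>L\<close> is arbitrary, whereas a Lipschitz constant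
    has to be nonnegative.\<close>
  have "\<bar>L\<bar>-lipschitz_on {\<alpha>..\<gamma>} F"
  proof (rule bounded_derivative_imp_lipschitz)
    fix y assume y: "y \<in> {\<alpha>..\<gamma>}"
    show "(F has_derivative (*) (F' y)) (at y within {\<alpha>..\<gamma>})"
      using der[OF y] by (simp add: has_field_derivative_def)
    show "onorm ((*) (F' y)) \<le> \<bar>L\<bar>"
      using bspec[OF L y] by (intro onorm_le) (auto simp: abs_mult intro!: mult_right_mono)
  qed auto
  then show ?thesis by (rule that)
qed

text \<open>The verification estimate behind both upper bounds, used once with \<open>V\<close> and
  once with a multiple of a logarithm. A \<open>C1\<close> function is Lipschitz on a compact
  interval containing the range of the path, so the composition is again absolutely continuous and
  the chain rule can be integrated.\<close>

lemma chain_increment_le_nn_integral: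
  fixes F F' \<phi> h :: "real \<Rightarrow> real"
  assumes st: "s \<le> t" and ac: "abs_cont_on s t \<phi>" and ran: "\<phi> ` {s..t} \<subseteq> {\<alpha>..\<gamma>}"
    and der: "\<And>y. y \<in> {\<alpha>..\<gamma>} \<Longrightarrow> (F has_real_derivative F' y) (at y within {\<alpha>..\<gamma>})"
    and cont: "continuous_on {\<alpha>..\<gamma>} F'"
    and h: "AE u in lebesgue. s < u \<and> u < t \<longrightarrow>
        (\<exists>D. (\<phi> has_real_derivative D) (at u) \<and> F' (\<phi> u) * D \<le> h u)"
  shows "ereal (F (\<phi> t) - F (\<phi> s)) \<le> enn2ereal (\<integral>\<^sup>+u\<in>{s..t}. ennreal (h u) \<partial>lebesgue)"
proof -
  obtain L where L: "L-lipschitz_on {\<alpha>..\<gamma>} F"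
    using C1_imp_lipschitz_on[OF der cont] by blast
  have "abs_cont_on s t (\<lambda>u. F (\<phi> u))"
    by (rule abs_cont_on_lipschitz_compose[OF ac L ran])
  moreover have "AE u in lebesgue. s < u \<and> u < t \<longrightarrow>
        (\<exists>D \<le> h u. ((\<lambda>u. F (\<phi> u)) has_real_derivative D) (at u within {s..t}))"
    using h
  proof eventually_elim
    case (elim u)
    show ?case
    proof
      assume u: "s < u \<and> u < t"
      with elim obtain D where D: "(\<phi> has_real_derivative D) (at u)" "F' (\<phi> u) * D \<le> h u" by blast
      have "\<phi> u \<in> {\<alpha>..\<gamma>}" using u image_subset_iff[THEN iffD1, OF ran] by simp
      then have "(F has_real_derivative F' (\<phi> u)) (at (\<phi> u) within \<phi> ` {s..t})"
        using der ran has_field_derivative_subset by blast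
      moreover have "(\<phi> has_real_derivative D) (at u within {s..t})"
        using D(1) by (rule has_field_derivative_at_within)
      ultimately have "(F \<circ> \<phi> has_real_derivative F' (\<phi> u) * D) (at u within {s..t})"
        by (rule DERIV_image_chain)
      then show "\<exists>D \<le> h u. ((\<lambda>u. F (\<phi> u)) has_real_derivative D) (at u within {s..t})"
        using D(2) by (auto simp: o_def)
    qed
  qed
  ultimately show ?thesis
    by (rule abs_cont_on_increment_le_nn_integral[OF st])
qed

section \<open>Autonomous equations with a Lipschitz right-hand side\<close>

text \<open>Picard iteration on the whole half-line: in the unknown \<open>u t = exp (- 2 * K * t) * (\<phi> t - x)\<close>
  the integral equation is a contraction of the bounded continuous functions.\<close>

lemma lipschitz_autonomous_ode:
  fixes F :: "real \<Rightarrow> real"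
  assumes F: "L-lipschitz_on UNIV F"
  obtains \<phi> where "\<phi> 0 = x" "\<And>t. 0 \<le> t \<Longrightarrow> (\<phi> has_real_derivative F (\<phi> t)) (at t within {0..})"
proof -
  define K where "K = L + 1"
  have K: "0 < K" using lipschitz_on_nonneg[OF F] by (simp add: K_def)
  have FK: "\<bar>F y - F z\<bar> \<le> K * \<bar>y - z\<bar>" for y z
  proof -
    have "\<bar>F y - F z\<bar> \<le> L * \<bar>y - z\<bar>"
      using lipschitz_onD[OF F, of y z] by (simp add: dist_real_def)
    also have "\<dots> \<le> K * \<bar>y - z\<bar>" by (intro mult_right_mono) (auto simp: K_def)
    finally show ?thesis .
  qed
  have cF: "continuous_on S F" for S
    using lipschitz_on_continuous_on[OF F] continuous_on_subset by blast
  \<comment> \<open>The exponent \<open>2 * K\<close> yields the contraction constant 1/2: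
    integrating \<open>w\<close> produces the factor \<open>1 / (2 * K)\<close>, and the Lipschitz
    bound costs a factor \<open>K\<close>.\<close>
  define w where "w t = exp (2 * K * t)" for t :: real
  have w: "0 < w t" "continuous_on S w" for t S
    by (auto simp: w_def intro!: continuous_intros)
  have w1: "1 \<le> w t" if "0 \<le> t" for t using that K by (simp add: w_def)
  have intw: "((\<lambda>s. C * w s) has_integral C * (w t - 1) / (2 * K)) {0..t}" if "0 \<le> t" for C t
  proof -
    have "((\<lambda>s. C * w s) has_integral C * w t / (2 * K) - C * w 0 / (2 * K)) {0..t}"
      using that K
      by (intro fundamental_theorem_of_calculus)
         (auto simp: w_def has_real_derivative_iff_has_vector_derivative[symmetric]
           intro!: derivative_eq_intros)
    then show ?thesis by (simp add: w_def diff_divide_distrib right_diff_distrib)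
  qed
  have int_le: "\<bar>integral {0..t} g\<bar> \<le> C / (2 * K) * w t"
    if t: "0 \<le> t" and g: "continuous_on {0..t} g" "\<And>s. s \<in> {0..t} \<Longrightarrow> \<bar>g s\<bar> \<le> C * w s"
      and C: "0 \<le> C" for t g C
  proof -
    have "norm (integral {0..t} g) \<le> integral {0..t} (\<lambda>s. C * w s)"
      using g w(2) by (intro integral_norm_bound_integral integrable_continuous_real continuous_intros) auto
    also have "\<dots> = C * (w t - 1) / (2 * K)" by (rule integral_unique[OF intw[OF t]])
    also have "\<dots> \<le> C * w t / (2 * K)"
      using K C by (intro divide_right_mono mult_left_mono) auto
    finally show ?thesis by simp
  qed
  define G where "G u s = F (x + w s * u s)" for u :: "real \<Rightarrow> real" and s
  \<comment> \<open>Negative times are sent to 0, so that the operator acts on bounded continuous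
    functions on the whole line.\<close>
  define P where "P u t = integral {0..max 0 t} (G u) / w (max 0 t)" for u :: "real \<Rightarrow> real" and t
  have cG: "continuous_on S (G u)" if "continuous_on S u" for S u
    unfolding G_def using that
    by (intro continuous_on_compose2[OF cF[of UNIV]] continuous_intros w) auto
  have Pb: "P u \<in> bcontfun" if u: "continuous_on UNIV u" "bounded (range u)" for u
  proof -
    obtain B where B: "\<And>s. \<bar>u s\<bar> \<le> B" using u(2) by (auto simp: bounded_iff)
    have B0: "0 \<le> B" using B[of 0] by linarith
    have "continuous_on UNIV (\<lambda>t. integral {0..max 0 t} (G u))"
    proof (rule continuous_at_imp_continuous_on, rule ballI)
      fix t :: real
      have "continuous_on {0..\<bar>t\<bar> + 1} (\<lambda>s. integral {0..s} (G u))"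
        using cG[OF continuous_on_subset[OF u(1)]]
        by (intro indefinite_integral_continuous_1 integrable_continuous_real) auto
      then have "continuous_on {-1-\<bar>t\<bar><..<\<bar>t\<bar> + 1} (\<lambda>t. integral {0..max 0 t} (G u))"
        by (rule continuous_on_compose2) (auto intro!: continuous_intros)
      then show "isCont (\<lambda>t. integral {0..max 0 t} (G u)) t"
        by (rule continuous_on_interior) auto
    qed
    then have "continuous_on UNIV (P u)"
      unfolding P_def using w(1)
      by (intro continuous_intros continuous_on_compose2[OF w(2)[of UNIV]]) (auto simp: less_imp_neq[symmetric])
    moreover have "\<bar>P u t\<bar> \<le> (\<bar>F x\<bar> + K * B) / (2 * K)" for t
    proof -
      have "\<bar>G u s\<bar> \<le> (\<bar>F x\<bar> + K * B) * w s" if "s \<in> {0..max 0 t}" for s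
      proof -
        have "\<bar>G u s\<bar> \<le> \<bar>F x\<bar> + K * \<bar>w s * u s\<bar>"
          using FK[of "x + w s * u s" x] by (simp add: G_def)
        also have "\<dots> \<le> \<bar>F x\<bar> * w s + K * (w s * B)"
          using w1[of s] w(1)[of s] that B[of s] K
          by (intro add_mono mult_left_mono) (auto simp: abs_mult mult_le_cancel_left1)
        finally show ?thesis by (simp add: algebra_simps)
      qed
      then have "\<bar>integral {0..max 0 t} (G u)\<bar> \<le> (\<bar>F x\<bar> + K * B) / (2 * K) * w (max 0 t)"
        using K B0 by (intro int_le cG continuous_on_subset[OF u(1)]) auto
      then show ?thesis
        using w(1)[of "max 0 t"] by (simp add: P_def divide_le_eq)
    qed
    ultimately show ?thesis
      by (auto simp: bcontfun_def bounded_iff)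
  qed
  define \<Phi> where "\<Phi> u = Bcontfun (P (apply_bcontfun u))" for u :: "real \<Rightarrow>\<^sub>C real"
  have \<Phi>: "apply_bcontfun (\<Phi> u) = P (apply_bcontfun u)" for u
    unfolding \<Phi>_def by (intro Bcontfun_inverse Pb) auto
  have "dist (\<Phi> u) (\<Phi> v) \<le> 1 / 2 * dist u v" for u v
  proof (rule dist_bound)
    fix t :: real
    let ?t = "max 0 t"
    have cu: "continuous_on S (G (apply_bcontfun u))" "continuous_on S (G (apply_bcontfun v))" for S
      by (intro cG; simp)+
    have "\<bar>integral {0..?t} (\<lambda>s. G u s - G v s)\<bar> \<le> K * dist u v / (2 * K) * w ?t"
    proof (rule int_le)
      fix s assume "s \<in> {0..?t}"
      have "\<bar>G u s - G v s\<bar> \<le> K * \<bar>w s * u s - w s * v s\<bar>"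
        using FK[of "x + w s * u s" "x + w s * v s"] by (simp add: G_def)
      also have "\<dots> = K * (w s * dist (u s) (v s))"
        using w(1)[of s] by (simp add: dist_real_def abs_mult right_diff_distrib[symmetric])
      also have "\<dots> \<le> K * (w s * dist u v)"
        using K w(1)[of s] by (intro mult_left_mono dist_bounded) auto
      finally show "\<bar>G u s - G v s\<bar> \<le> K * dist u v * w s" by (simp add: mult_ac)
    qed (use K in \<open>auto intro!: continuous_intros cu\<close>)
    moreover have "integral {0..?t} (\<lambda>s. G u s - G v s) = integral {0..?t} (G u) - integral {0..?t} (G v)"
      by (intro integral_diff integrable_continuous_real cu)
    ultimately have "\<bar>integral {0..?t} (G u) - integral {0..?t} (G v)\<bar> / w ?t \<le> dist u v / 2"
      using K w(1)[of ?t] by (simp add: divide_le_eq)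
    then show "dist (\<Phi> u t) (\<Phi> v t) \<le> 1 / 2 * dist u v"
      using w(1)[of ?t] by (simp add: \<Phi> P_def dist_real_def diff_divide_distrib[symmetric])
  qed
  then obtain u where u: "\<Phi> u = u"
    using banach_fix_type[of "1/2" \<Phi>] by auto
  define \<phi> where "\<phi> t = x + integral {0..t} (G u)" for t
  have \<phi>: "G u t = F (\<phi> t)" if "0 \<le> t" for t
  proof -
    have "u t = integral {0..t} (G u) / w t"
      using arg_cong[OF u, of "\<lambda>v. apply_bcontfun v t"] that by (simp add: \<Phi> P_def)
    then show ?thesis using w(1)[of t] by (simp add: G_def \<phi>_def)
  qed
  show ?thesis
  proof
    show "\<phi> 0 = x" by (simp add: \<phi>_def)
    fix t :: real assume t: "0 \<le> t"
    have "((\<lambda>s. integral {0..s} (G u)) has_real_derivative G u t) (at t within {0..t+1})"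
      using t by (intro integral_has_real_derivative cG) auto
    then have "(\<phi> has_real_derivative F (\<phi> t)) (at t within {0..t+1})"
      using \<phi>[OF t] unfolding \<phi>_def by (auto intro!: derivative_eq_intros)
    then show "(\<phi> has_real_derivative F (\<phi> t)) (at t within {0..})"
      using t by (subst (asm) at_within_nhd[of t "{..<t+1}" _ "{0..}"]) auto
  qed
qed

lemma ode_solution_abs_cont:
  assumes F: "L-lipschitz_on UNIV F"
    and der: "\<And>t. 0 \<le> t \<Longrightarrow> (\<phi> has_real_derivative F (\<phi> t)) (at t within {0..})"
  shows "abs_cont_halfline \<phi>"
  unfolding abs_cont_halfline_def
proof (intro allI impI)
  fix t :: real
  have der': "(\<phi> has_real_derivative F (\<phi> u)) (at u within {0..t})" if "u \<in> {0..t}" for u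
    using der[of u] that by (auto intro: has_field_derivative_subset)
  have "continuous_on {0..t} \<phi>"
    using der' by (rule DERIV_continuous_on)
  then have "continuous_on {0..t} (\<lambda>u. F (\<phi> u))"
    using lipschitz_on_continuous_on[OF F] by (auto intro: continuous_on_compose2)
  then show "abs_cont_on 0 t \<phi>"
    using C1_imp_lipschitz_on[OF der'] lipschitz_imp_abs_cont_on by metis
qed

section \<open>Hitting times and costs\<close>

lemma abs_cont_halfline_imp_continuous_on:
  "abs_cont_halfline f \<Longrightarrow> continuous_on {0..t} f"
  by (cases "0 \<le> t") (auto simp: abs_cont_halfline_def intro: abs_cont_on_imp_continuous_on)

lemma hit_time_eqI:
  assumes "0 \<le> \<tau>" "\<phi> \<tau> = a" "\<And>t. 0 \<le> t \<Longrightarrow> t < \<tau> \<Longrightarrow> \<phi> t \<noteq> a"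
  shows "hit_time a \<phi> = ereal \<tau>"
  unfolding hit_time_def
proof (rule INF_eqI)
  show "ereal \<tau> \<le> ereal t" if "t \<in> {t. 0 \<le> t \<and> \<phi> t = a}" for t
    using assms(3)[of t] that by force
qed (use assms in auto)

lemma hit_time_attained:
  assumes ac: "abs_cont_halfline \<phi>" and le: "hit_time a \<phi> \<le> ereal T"
  obtains \<tau> where "0 \<le> \<tau>" "\<tau> \<le> T" "\<phi> \<tau> = a" "hit_time a \<phi> = ereal \<tau>"
    "\<And>t. 0 \<le> t \<Longrightarrow> t < \<tau> \<Longrightarrow> \<phi> t \<noteq> a"
proof -
  \<comment> \<open>The window extends beyond \<open>T\<close>: without a hit in it, the infimum
    would be at least \<open>T + 1\<close>. A window ending at \<open>T\<close> would leave open an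
    infimum equal to \<open>T\<close> approached from the right.\<close>
  define S where "S = {0..T + 1} \<inter> \<phi> -` {a}"
  have "continuous_on {0..T + 1} \<phi>"
    by (rule abs_cont_halfline_imp_continuous_on[OF ac])
  then have "closed S" unfolding S_def
    by (intro continuous_closed_preimage) auto
  moreover have "S \<noteq> {}"
  proof
    assume S: "S = {}"
    have "ereal (T + 1) \<le> hit_time a \<phi>"
      unfolding hit_time_def
    proof (rule INF_greatest)
      fix t assume "t \<in> {t. 0 \<le> t \<and> \<phi> t = a}"
      then show "ereal (T + 1) \<le> ereal t"
        using S by (cases "t \<le> T + 1") (auto simp: S_def)
    qed
    then have "ereal (T + 1) \<le> ereal T" using le by (rule order_trans)
    then show False by simp
  qed
  moreover have bdd: "bdd_below S" by (auto simp: S_def bdd_below_def)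
  ultimately have "Inf S \<in> S" by (intro closed_contains_Inf)
  moreover have "\<phi> t \<noteq> a" if "0 \<le> t" "t < Inf S" for t
  proof
    assume "\<phi> t = a"
    moreover have "Inf S \<le> T + 1" using \<open>Inf S \<in> S\<close> by (simp add: S_def)
    ultimately have "t \<in> S" using that by (auto simp: S_def)
    then have "Inf S \<le> t" using bdd by (rule cInf_lower)
    then show False using that by simp
  qed
  moreover from calculation have "hit_time a \<phi> = ereal (Inf S)"
    by (intro hit_time_eqI) (auto simp: S_def)
  moreover from this have "Inf S \<le> T" using le by simp
  ultimately show ?thesis by (intro that[of "Inf S"]) (auto simp: S_def)
qed

text \<open>By the intermediate value theorem a path cannot pass below \<open>a\<close> without
  hitting it. This keeps the state in the region where \<open>e\<close> and \<open>l\<close> are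
  controlled.\<close>

lemma above_before_hit:
  assumes ac: "abs_cont_halfline \<phi>" and "a \<le> \<phi> 0" and t: "0 \<le> t" "ereal t < hit_time a \<phi>"
  shows "a < \<phi> t"
proof (rule ccontr)
  assume "\<not> a < \<phi> t"
  moreover have "continuous_on {0..t} \<phi>"
    by (rule abs_cont_halfline_imp_continuous_on[OF ac])
  ultimately obtain u where "0 \<le> u" "u \<le> t" "\<phi> u = a"
    using IVT2'[of \<phi> t a 0] assms(2) t(1) by auto
  then have "hit_time a \<phi> \<le> ereal u" unfolding hit_time_def by (intro INF_lower) auto
  with t(2) \<open>u \<le> t\<close> show False
    by (metis ereal_less_eq(3) not_less order_trans)
qed

lemma path_cost_hit:
  assumes "hit_time a \<phi> = ereal \<tau>" "\<tau> \<le> T"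
  shows "path_cost a lam \<rho> l \<psi> \<phi> T =
    ereal \<rho> - enn2ereal (\<integral>\<^sup>+ t \<in> {0..\<tau>}. ennreal (lam - l (\<phi> t) + (deriv \<psi> t)\<^sup>2 / 2) \<partial>lebesgue)"
proof -
  have "{t. 0 \<le> t \<and> ereal t \<le> min (ereal T) (hit_time a \<phi>)} = {0..\<tau>}"
    using assms by auto
  then show ?thesis using assms by (simp add: path_cost_def)
qed

lemma path_cost_not_hit:
  assumes "\<not> hit_time a \<phi> \<le> ereal T"
  shows "path_cost a lam \<rho> l \<psi> \<phi> T \<le> 0"
  using assms by (simp add: path_cost_def zero_ereal_def[symmetric] ereal_minus_le_iff)

lemma path_cost_le: "path_cost a lam \<rho> l \<psi> \<phi> T \<le> ereal (max \<rho> 0)"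
  unfolding path_cost_def by (intro ereal_diff_le_self order_trans[OF ereal_diff_le_self]) auto

lemma path_cost_time_zero:
  assumes "0 < hit_time a \<phi>"
  shows "path_cost a lam \<rho> l \<psi> \<phi> 0 = 0"
proof -
  have "{t. 0 \<le> t \<and> ereal t \<le> min (ereal 0) (hit_time a \<phi>)} = {0}"
    using assms by (auto simp: zero_ereal_def[symmetric] min_def)
  moreover have "(\<integral>\<^sup>+ t \<in> {0}. ennreal (lam - l (\<phi> t) + (deriv \<psi> t)\<^sup>2 / 2) \<partial>lebesgue) = 0"
    by (rule nn_integral_null_set) (auto intro: null_setsI)
  ultimately show ?thesis using assms
    by (simp add: path_cost_def zero_ereal_def[symmetric] not_le zero_ennreal.rep_eq)
qed

lemma worst_cost_leI:
  assumes "\<And>\<psi> T \<phi>. \<psi> \<in> AC0 \<Longrightarrow> 0 \<le> T \<Longrightarrow> is_state \<mu> r \<sigma> a e x p \<psi> \<phi> \<Longrightarrow>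
      path_cost a lam \<rho> l \<psi> \<phi> T \<le> c"
  shows "worst_cost \<mu> r \<sigma> a lam \<rho> e l x p \<le> c"
  unfolding worst_cost_def game_cost_def using assms by (auto intro!: SUP_least)

lemma path_cost_le_worst_cost:
  assumes "\<psi> \<in> AC0" "0 \<le> T" "is_state \<mu> r \<sigma> a e x p \<psi> \<phi>"
  shows "path_cost a lam \<rho> l \<psi> \<phi> T \<le> worst_cost \<mu> r \<sigma> a lam \<rho> e l x p"
proof -
  have "path_cost a lam \<rho> l \<psi> \<phi> T \<le> game_cost \<mu> r \<sigma> a lam \<rho> e l x p \<psi> T"
    unfolding game_cost_def using assms(3) by (intro SUP_upper) auto
  also have "\<dots> \<le> worst_cost \<mu> r \<sigma> a lam \<rho> e l x p"
    unfolding worst_cost_def using assms(1,2)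
    by (intro SUP_upper2[of "(\<psi>, T)"]) auto
  finally show ?thesis .
qed

section \<open>The lower bound\<close>

locale investment_game =
  fixes \<mu> r \<sigma> M0 M1 a lam \<rho> :: real and e l :: "real \<Rightarrow> real"
  assumes r_less: "r < \<mu>" and sigma_pos: "0 < \<sigma>" and rho_pos: "0 < \<rho>"
    and e_lipschitz: "lipschitz_from a e" and e_le: "\<And>x. a \<le> x \<Longrightarrow> e x \<le> M0"
    and l_lipschitz: "lipschitz_from a l" and l_less: "\<And>x. a \<le> x \<Longrightarrow> l x < lam"
    and l_antimono: "antimono_on {a..} l"
    and M1_pos: "0 < M1"
    and pi_star_le: "\<And>x. a \<le> x \<Longrightarrow> \<bar>pi_star \<mu> r \<sigma> a lam \<rho> e l x\<bar> \<le> M1"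
begin

definition \<beta> :: real where "\<beta> = (\<mu> - r) / \<sigma>"
definition \<kappa> :: "real \<Rightarrow> real" where "\<kappa> y = lam - l y + \<beta>\<^sup>2 / 2"

abbreviation "V \<equiv> V_formula \<mu> r \<sigma> a lam \<rho> e l"
abbreviation "d \<equiv> d_level \<mu> r \<sigma> a lam \<rho> e l"
abbreviation "\<pi>s \<equiv> pi_star \<mu> r \<sigma> a lam \<rho> e l"
abbreviation "state \<equiv> is_state \<mu> r \<sigma> a e"
abbreviation "cost \<equiv> path_cost a lam \<rho> l"
abbreviation "worst \<equiv> worst_cost \<mu> r \<sigma> a lam \<rho> e l"
abbreviation "game \<equiv> game_value \<mu> r \<sigma> M1 a lam \<rho> e l"

lemma beta_pos: "0 < \<beta>"
  using r_less sigma_pos by (simp add: \<beta>_def)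

text \<open>A lower bound uniform in \<open>y\<close>. It makes \<open>e / \<kappa>\<close>
  Lipschitz below \<open>d\<close> and lets \<open>\<kappa> / e\<close> inherit the divergence of
  \<open>1 / e\<close> at a zero of \<open>e\<close>.\<close>

lemma kappa_ge: "a \<le> y \<Longrightarrow> \<beta>\<^sup>2 / 2 \<le> \<kappa> y"
  using l_less[of y] by (simp add: \<kappa>_def)

lemma kappa_pos: "a \<le> y \<Longrightarrow> 0 < \<kappa> y"
  using kappa_ge[of y] beta_pos by (smt (verit) zero_less_power half_gt_zero)

lemma e_continuous_on: "S \<subseteq> {a..} \<Longrightarrow> continuous_on S e"
  using e_lipschitz lipschitz_on_continuous_on continuous_on_subset
  unfolding lipschitz_from_def by blast

lemma kappa_continuous_on: "S \<subseteq> {a..} \<Longrightarrow> continuous_on S \<kappa>"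
  using l_lipschitz lipschitz_on_continuous_on continuous_on_subset
  unfolding lipschitz_from_def \<kappa>_def by (intro continuous_intros) blast

lemma V_eq: "V y = \<rho> - integral {a..y} (\<lambda>u. \<kappa> u / e u)"
  by (simp add: V_formula_def \<kappa>_def \<beta>_def add_diff_eq diff_add_eq)

lemma V_start: "V a = \<rho>"
  by (simp add: V_eq)

lemma V_has_real_derivative:
  assumes "\<And>y. y \<in> {a..m} \<Longrightarrow> 0 < e y" "y \<in> {a..m}"
  shows "(V has_real_derivative - (\<kappa> y / e y)) (at y within {a..m})"
proof -
  have "continuous_on {a..m} (\<lambda>u. \<kappa> u / e u)"
    using assms(1) by (intro continuous_intros kappa_continuous_on e_continuous_on) (auto simp: less_imp_neq[symmetric])
  then have "((\<lambda>y. integral {a..y} (\<lambda>u. \<kappa> u / e u)) has_real_derivative \<kappa> y / e y) (at y within {a..m})"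
    using assms(2) by (rule integral_has_real_derivative)
  then show ?thesis
    unfolding V_eq by (auto intro!: derivative_eq_intros)
qed

lemma neg_kappa_div_e_continuous_on:
  assumes "\<And>y. y \<in> {a..m} \<Longrightarrow> 0 < e y"
  shows "continuous_on {a..m} (\<lambda>y. - (\<kappa> y / e y))"
  using assms by (intro continuous_intros kappa_continuous_on e_continuous_on) (auto simp: less_imp_neq[symmetric])

text \<open>With slope \<open>- \<beta>\<close> the terms \<open>(\<mu> - r) * p\<close> and
  \<open>\<sigma> * p * \<psi>'\<close> cancel pointwise, so one path serves every feedback
  \<open>p\<close>, even a discontinuous one. \<open>F\<close> stands for a globally Lipschitz field
  that agrees with \<open>- e\<close> along the path before the hit.\<close>

lemma uncontrolled_state:
  assumes F: "L-lipschitz_on UNIV F"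
    and der: "\<And>t. 0 \<le> t \<Longrightarrow> (\<phi> has_real_derivative F (\<phi> t)) (at t within {0..})"
    and Fe: "\<And>t. 0 < t \<Longrightarrow> ereal t < hit_time a \<phi> \<Longrightarrow> F (\<phi> t) = - e (\<phi> t)"
    and ac: "abs_cont_halfline \<phi>"
  shows "state (\<phi> 0) p (\<lambda>t. - \<beta> * t) \<phi>"
proof -
  have "(\<phi> has_real_derivative - e (\<phi> t) + (\<mu> - r) * p (\<phi> t) + \<sigma> * p (\<phi> t) * deriv (\<lambda>t. - \<beta> * t) t) (at t)"
    if t: "0 < t" "ereal t < hit_time a \<phi>" for t
  proof -
    have "deriv (\<lambda>t. - \<beta> * t) t = - \<beta>"
      by (intro DERIV_imp_deriv) (auto intro!: derivative_eq_intros)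
    moreover have "(\<phi> has_real_derivative F (\<phi> t)) (at t)"
      using der[of t] t(1) at_within_interior[of t "{0..}"] by simp
    ultimately show ?thesis
      using Fe[OF t] sigma_pos by (simp add: \<beta>_def)
  qed
  then show ?thesis using ac by (simp add: is_state_def)
qed

lemma linear_AC0: "(\<lambda>t. - \<beta> * t) \<in> AC0"
proof -
  have "\<bar>\<beta>\<bar>-lipschitz_on {0..t} (\<lambda>t. - \<beta> * t)" for t
    by (rule lipschitz_onI) (auto simp: dist_real_def abs_mult[symmetric] algebra_simps)
  then have "abs_cont_on 0 t (\<lambda>t. - \<beta> * t)" for t
    by (rule lipschitz_imp_abs_cont_on)
  then show ?thesis
    by (simp add: AC0_def abs_cont_halfline_def)
qed

text \<open>\<open>e\<close> is Lipschitz only on \<open>{a..}\<close>. Composition with a clamp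
  \<open>q\<close> gives a field on the whole line, as the existence theorem requires.\<close>

lemma e_clamped_lipschitz:
  assumes "1-lipschitz_on UNIV q" "range q \<subseteq> {a..}"
  obtains L where "L-lipschitz_on UNIV (\<lambda>y. - e (q y))"
proof -
  obtain L where "L-lipschitz_on {a..} e" using e_lipschitz by (auto simp: lipschitz_from_def)
  then have "L-lipschitz_on (range q) e" using assms(2) lipschitz_on_subset by blast
  from lipschitz_on_compose2[OF assms(1) this] show ?thesis
    by (intro that[of "L * 1"]) (simp add: lipschitz_on_minus)
qed

text \<open>Stopping at time 0 yields 0 only if a solution exists, since the supremum over an empty
  set of paths is minus infinity. For a discontinuous \<open>p\<close> existence may fail for some
  inputs; the input of slope \<open>- \<beta>\<close> always has a solution.\<close>

lemma worst_nonneg: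
  assumes "a < x"
  shows "0 \<le> worst x p"
proof -
  have "1-lipschitz_on UNIV (\<lambda>y. max a y)"
    by (rule lipschitz_onI) (auto simp: dist_real_def)
  then obtain L where L: "L-lipschitz_on UNIV (\<lambda>y. - e (max a y))"
    using e_clamped_lipschitz[of "\<lambda>y. max a y"] by (auto simp: image_subset_iff)
  obtain \<phi> where \<phi>: "\<phi> 0 = x"
    "\<And>t. 0 \<le> t \<Longrightarrow> (\<phi> has_real_derivative - e (max a (\<phi> t))) (at t within {0..})"
    using lipschitz_autonomous_ode[OF L] by blast
  have ac: "abs_cont_halfline \<phi>" by (rule ode_solution_abs_cont[OF L \<phi>(2)])
  have "state (\<phi> 0) p (\<lambda>t. - \<beta> * t) \<phi>"
  proof (rule uncontrolled_state[OF L \<phi>(2) _ ac])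
    fix t assume "0 < t" "ereal t < hit_time a \<phi>"
    then show "- e (max a (\<phi> t)) = - e (\<phi> t)"
      using above_before_hit[OF ac, of a t] \<phi>(1) assms by (simp add: max_def)
  qed
  then have "cost (\<lambda>t. - \<beta> * t) \<phi> 0 \<le> worst x p"
    using \<phi>(1) linear_AC0 by (intro path_cost_le_worst_cost) auto
  moreover have "0 < hit_time a \<phi>"
  proof (rule ccontr)
    assume "\<not> 0 < hit_time a \<phi>"
    then have "hit_time a \<phi> \<le> ereal 0" by (simp add: zero_ereal_def[symmetric] not_less)
    then obtain \<tau> where "0 \<le> \<tau>" "\<tau> \<le> 0" "\<phi> \<tau> = a"
      using hit_time_attained[OF ac] by metis
    then show False using \<phi>(1) assms by simp
  qed
  ultimately show ?thesis by (simp add: path_cost_time_zero)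
qed

lemma V_le_worst:
  assumes e_pos: "\<And>y. y \<in> {a..x} \<Longrightarrow> 0 < e y" and x: "a \<le> x"
  shows "ereal (V x) \<le> worst x p"
proof -
  \<comment> \<open>Clamping on both sides keeps the argument of \<open>e\<close> in
    \<open>{a..x}\<close>, where \<open>e\<close> has a positive minimum \<open>m\<close>. The path
    therefore descends at speed at least \<open>m\<close> and hits \<open>a\<close> by time
    \<open>(x - a) / m\<close>.\<close>
  define q where "q y = max a (min x y)" for y
  have q: "q y \<in> {a..x}" for y using x by (simp add: q_def)
  have "1-lipschitz_on UNIV q"
    by (rule lipschitz_onI) (auto simp: dist_real_def q_def)
  then obtain L where L: "L-lipschitz_on UNIV (\<lambda>y. - e (q y))"
    using e_clamped_lipschitz[of q] q by auto
  obtain \<phi> where \<phi>: "\<phi> 0 = x"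
    "\<And>t. 0 \<le> t \<Longrightarrow> (\<phi> has_real_derivative - e (q (\<phi> t))) (at t within {0..})"
    using lipschitz_autonomous_ode[OF L] by blast
  have ac: "abs_cont_halfline \<phi>" by (rule ode_solution_abs_cont[OF L \<phi>(2)])
  obtain m where m: "0 < m" "\<And>y. y \<in> {a..x} \<Longrightarrow> m \<le> e y"
  proof -
    obtain y0 where "y0 \<in> {a..x}" "\<forall>y\<in>{a..x}. e y0 \<le> e y"
      using continuous_attains_inf[of "{a..x}" e] e_continuous_on[of "{a..x}"] x by auto
    then show ?thesis using e_pos that[of "e y0"] by blast
  qed
  have decr: "\<phi> t \<le> x - m * t" if t: "0 \<le> t" for t
  proof -
    have "\<exists>z\<in>{0..t}. \<phi> t - \<phi> 0 = (- e (q (\<phi> z))) * (t - 0)"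
    proof (rule mvt_very_simple[OF t])
      fix u assume "0 \<le> u" "u \<le> t"
      then have "(\<phi> has_real_derivative - e (q (\<phi> u))) (at u within {0..t})"
        using \<phi>(2)[of u] by (auto intro: has_field_derivative_subset)
      then show "(\<phi> has_derivative (*) (- e (q (\<phi> u)))) (at u within {0..t})"
        by (simp add: has_field_derivative_def)
    qed
    then obtain z where z: "\<phi> t - x = (- e (q (\<phi> z))) * t" using \<phi>(1) by auto
    have "m * t \<le> e (q (\<phi> z)) * t" using m(2)[OF q] t by (intro mult_right_mono) auto
    then show ?thesis using z by simp
  qed
  have "hit_time a \<phi> \<le> ereal ((x - a) / m)"
  proof -
    let ?T = "(x - a) / m"
    have T: "0 \<le> ?T" using x m(1) by simp
    have "\<phi> ?T \<le> a" using decr[OF T] m(1) by simp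
    moreover have "continuous_on {0..?T} \<phi>"
      by (rule abs_cont_halfline_imp_continuous_on[OF ac])
    ultimately obtain u where "0 \<le> u" "u \<le> ?T" "\<phi> u = a"
      using IVT2'[of \<phi> ?T a 0] \<phi>(1) x T by auto
    then show ?thesis
      unfolding hit_time_def by (intro INF_lower2[of u]) auto
  qed
  then obtain \<tau> where \<tau>: "0 \<le> \<tau>" "\<phi> \<tau> = a" "hit_time a \<phi> = ereal \<tau>"
    using hit_time_attained[OF ac] by metis
  have ran: "\<phi> t \<in> {a..x}" if "t \<in> {0..\<tau>}" for t
  proof (cases "t = \<tau>")
    case False
    then have "a < \<phi> t" using above_before_hit[OF ac] that \<tau>(3) \<phi>(1) x by auto
    moreover have "\<phi> t \<le> x" using decr[of t] that m(1) by (smt (verit) mult_nonneg_nonneg atLeastAtMost_iff)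
    ultimately show ?thesis by simp
  qed (use \<tau>(2) x in simp)
  have qeq: "q y = y" if "y \<in> {a..x}" for y using that by (simp add: q_def)
  have st: "state x p (\<lambda>t. - \<beta> * t) \<phi>"
    unfolding \<phi>(1)[symmetric]
  proof (rule uncontrolled_state[OF L \<phi>(2) _ ac])
    fix t assume "0 < t" "ereal t < hit_time a \<phi>"
    then show "- e (q (\<phi> t)) = - e (\<phi> t)"
      using ran[of t] \<tau>(3) by (simp add: qeq)
  qed
  \<comment> \<open>Along this path \<open>V\<close> grows at rate \<open>\<kappa>\<close>, which is
    exactly the running cost at slope \<open>- \<beta>\<close>. Hence the total running cost is
    \<open>\<rho> - V x\<close>.\<close>
  have "((\<lambda>t. \<kappa> (\<phi> t)) has_integral V (\<phi> \<tau>) - V (\<phi> 0)) {0..\<tau>}"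
  proof (rule fundamental_theorem_of_calculus[OF \<tau>(1)])
    fix t assume t: "t \<in> {0..\<tau>}"
    have "(\<phi> has_real_derivative - e (\<phi> t)) (at t within {0..\<tau>})"
      using \<phi>(2)[of t] t qeq[OF ran[OF t]] by (auto intro: has_field_derivative_subset)
    moreover have "(V has_real_derivative - (\<kappa> (\<phi> t) / e (\<phi> t))) (at (\<phi> t) within \<phi> ` {0..\<tau>})"
      using V_has_real_derivative[OF e_pos ran[OF t]] by (rule has_field_derivative_subset) (use ran in auto)
    ultimately have "(V \<circ> \<phi> has_real_derivative (- (\<kappa> (\<phi> t) / e (\<phi> t))) * (- e (\<phi> t))) (at t within {0..\<tau>})"
      by (intro DERIV_image_chain)
    then show "((\<lambda>t. V (\<phi> t)) has_vector_derivative \<kappa> (\<phi> t)) (at t within {0..\<tau>})"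
      using e_pos[OF ran[OF t]] by (simp add: has_real_derivative_iff_has_vector_derivative o_def)
  qed
  then have I: "((\<lambda>t. \<kappa> (\<phi> t)) has_integral \<rho> - V x) {0..\<tau>}"
    by (simp add: \<tau>(2) \<phi>(1) V_start)
  have k0: "0 \<le> \<kappa> (\<phi> t)" if "t \<in> {0..\<tau>}" for t
    using kappa_pos[of "\<phi> t"] ran[OF that] by auto
  have "(\<integral>\<^sup>+ t \<in> {0..\<tau>}. ennreal (lam - l (\<phi> t) + (deriv (\<lambda>t. - \<beta> * t) t)\<^sup>2 / 2) \<partial>lebesgue)
      = (\<integral>\<^sup>+ t \<in> {0..\<tau>}. ennreal (\<kappa> (\<phi> t)) \<partial>lebesgue)"
  proof -
    have "deriv (\<lambda>t. - \<beta> * t) t = - \<beta>" for t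
      by (intro DERIV_imp_deriv) (auto intro!: derivative_eq_intros)
    then show ?thesis by (simp add: \<kappa>_def)
  qed
  also have "\<dots> = ennreal (\<rho> - V x)"
    using nn_integral_has_integral_lebesgue'[OF k0 I] by (simp add: nn_integral_completion)
  finally have "cost (\<lambda>t. - \<beta> * t) \<phi> \<tau> = ereal \<rho> - enn2ereal (ennreal (\<rho> - V x))"
    using path_cost_hit[OF \<tau>(3) order_refl] by simp
  moreover have "0 \<le> \<rho> - V x"
    using has_integral_nonneg[OF I k0] .
  ultimately have "cost (\<lambda>t. - \<beta> * t) \<phi> \<tau> = ereal (V x)"
    by (simp add: enn2ereal_ennreal)
  then show ?thesis
    using path_cost_le_worst_cost[OF linear_AC0 \<tau>(1) st] by metis
qed

section \<open>The level d\<close>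

lemma a_le_d: "ereal a \<le> d"
  unfolding d_level_def b_level_def by (auto intro!: INF_greatest)

lemma d_le: "a < y \<Longrightarrow> V y = 0 \<Longrightarrow> d \<le> ereal y"
  unfolding d_level_def by (intro min.coboundedI2 INF_lower) auto

lemma d_le_of_e_neg: "a \<le> y \<Longrightarrow> e y < 0 \<Longrightarrow> d \<le> ereal y"
  unfolding d_level_def b_level_def by (intro min.coboundedI1 INF_lower) auto

lemma V_continuous_on:
  assumes "\<And>y. y \<in> {a..m} \<Longrightarrow> 0 < e y"
  shows "continuous_on {a..m} V"
  using V_has_real_derivative[OF assms] by (rule DERIV_continuous_on)

text \<open>\<open>V\<close> starts at \<open>\<rho> > 0\<close> and is continuous while
  \<open>e\<close> is positive, so it has a zero in between, and that zero enters the second infimum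
  of \<open>d_level\<close>.\<close>

lemma d_le_of_V_nonpos:
  assumes "\<And>y. y \<in> {a..m} \<Longrightarrow> 0 < e y" "a \<le> m" "V m \<le> 0"
  shows "d \<le> ereal m"
proof -
  obtain w where w: "a \<le> w" "w \<le> m" "V w = 0"
    using IVT2'[of V m 0 a] V_continuous_on[OF assms(1)] assms V_start rho_pos by auto
  then have "a < w" using V_start rho_pos by (cases "w = a") auto
  then have "d \<le> ereal w" using w(3) by (rule d_le)
  then show ?thesis using w(2) order_trans by fastforce
qed

text \<open>At a first zero \<open>z\<close> of \<open>e\<close> the integrand \<open>\<kappa> / e\<close> dominates a multiple of \<open>1 / (z - u)\<close>,
  so \<open>V\<close> has already vanished before \<open>z\<close>.\<close>

lemma e_pos_up_to_d:
  assumes ea: "0 < e a" and y: "a \<le> y" "ereal y \<le> d"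
  shows "0 < e y"
proof (rule ccontr)
  assume neg: "\<not> 0 < e y"
  define Z where "Z = {a..y} \<inter> e -` {..0}"
  define z where "z = Inf Z"
  have "closed Z" unfolding Z_def
    by (intro continuous_closed_preimage e_continuous_on) auto
  moreover have "Z \<noteq> {}" using neg y(1) by (auto simp: Z_def)
  moreover have bdd: "bdd_below Z" by (auto simp: Z_def bdd_below_def)
  ultimately have "z \<in> Z" unfolding z_def by (intro closed_contains_Inf)
  then have z: "a \<le> z" "z \<le> y" "e z \<le> 0" by (auto simp: Z_def)
  have az: "a < z" using z ea by (cases "z = a") auto
  have pos: "0 < e u" if "a \<le> u" "u < z" for u
  proof (rule ccontr)
    assume "\<not> 0 < e u"
    then have "u \<in> Z" using that z by (auto simp: Z_def)
    then have "z \<le> u" unfolding z_def using bdd by (rule cInf_lower)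
    then show False using that by simp
  qed
  obtain L where L: "L-lipschitz_on {a..} e" using e_lipschitz by (auto simp: lipschitz_from_def)
  have L0: "0 \<le> L" using L by (rule lipschitz_on_nonneg)
  \<comment> \<open>\<open>C\<close> combines the lower bound \<open>\<beta>\<^sup>2 / 2\<close> of
    \<open>\<kappa>\<close> with the estimate \<open>e u \<le> (L + 1) * (z - u)\<close>.\<close>
  define C where "C = \<beta>\<^sup>2 / 2 / (L + 1)"
  have C: "0 < C" using beta_pos L0 by (simp add: C_def)
  \<comment> \<open>\<open>c\<close> solves \<open>C * (ln (z - a) - ln (z - c)) = \<rho>\<close>:
    up to \<open>c\<close> the minorant \<open>C / (z - u)\<close> has used up all of
    \<open>\<rho>\<close>.\<close>
  define c where "c = z - (z - a) * exp (- (\<rho> / C))"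
  have "exp (- (\<rho> / C)) < 1" using rho_pos C by simp
  from mult_strict_left_mono[OF this, of "z - a"]
  have "(z - a) * exp (- (\<rho> / C)) < z - a" using az by simp
  moreover have "0 < (z - a) * exp (- (\<rho> / C))" using az by simp
  ultimately have c: "a < c" "c < z" unfolding c_def by linarith+
  have posc: "0 < e u" if "u \<in> {a..c}" for u using pos[of u] that c by auto
  have le: "C / (z - u) \<le> \<kappa> u / e u" if u: "u \<in> {a..c}" for u
  proof -
    have "e u - e z \<le> L * (z - u)"
      using lipschitz_onD[OF L, of u z] u c z by (auto simp: dist_real_def)
    then have eu: "e u \<le> (L + 1) * (z - u)" using z(3) u c by (simp add: algebra_simps)
    have "C / (z - u) = (\<beta>\<^sup>2 / 2) / ((L + 1) * (z - u))" by (simp add: C_def)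
    also have "\<dots> \<le> (\<beta>\<^sup>2 / 2) / e u"
      using eu posc[OF u] by (intro divide_left_mono) auto
    also have "\<dots> \<le> \<kappa> u / e u"
      using posc[OF u] kappa_ge[of u] u by (intro divide_right_mono) auto
    finally show ?thesis .
  qed
  have "((\<lambda>u. C / (z - u)) has_integral (- C * ln (z - c)) - (- C * ln (z - a))) {a..c}"
    using c by (intro fundamental_theorem_of_calculus)
      (auto simp: has_real_derivative_iff_has_vector_derivative[symmetric] intro!: derivative_eq_intros)
  moreover have "((\<lambda>u. \<kappa> u / e u) has_integral integral {a..c} (\<lambda>u. \<kappa> u / e u)) {a..c}"
    using posc by (intro integrable_integral integrable_continuous_real continuous_intros
        kappa_continuous_on e_continuous_on) (auto simp: less_imp_neq[symmetric])
  ultimately have "(- C * ln (z - c)) - (- C * ln (z - a)) \<le> integral {a..c} (\<lambda>u. \<kappa> u / e u)"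
    using le by (rule has_integral_le)
  moreover have "ln (z - c) = ln (z - a) - \<rho> / C"
    using az by (simp add: c_def ln_mult)
  ultimately have "V c \<le> 0"
    using C by (simp add: V_eq algebra_simps)
  then have "d \<le> ereal c"
    using posc c by (intro d_le_of_V_nonpos) auto
  also have "\<dots> < ereal y" using c z by simp
  finally show False using y(2) by simp
qed

lemma V_pos_below_d:
  assumes "0 < e a" "a \<le> y" "ereal y < d"
  shows "0 < V y"
proof (rule ccontr)
  assume "\<not> 0 < V y"
  moreover have "0 < e u" if u: "u \<in> {a..y}" for u
  proof (rule e_pos_up_to_d[OF assms(1)])
    have "ereal u \<le> ereal y" using u by simp
    also have "\<dots> \<le> d" using assms(3) by simp
    finally show "ereal u \<le> d" .
  qed (use u in simp)
  ultimately have "d \<le> ereal y"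
    using assms(2) by (intro d_le_of_V_nonpos) auto
  then show False using assms(3) by simp
qed

text \<open>At a finite \<open>d\<close> the function \<open>e\<close> is still positive. If
  \<open>V\<close> were nonzero there as well, both properties would persist up to some
  \<open>n\<close> to the right of \<open>d\<close>, and both infima defining \<open>d\<close> would
  be at least \<open>n\<close>.\<close>

lemma V_d_eq_0:
  assumes ea: "0 < e a" and d: "d = ereal d'"
  shows "V d' = 0"
proof (rule ccontr)
  assume V: "V d' \<noteq> 0"
  have a: "a \<le> d'" using a_le_d d by simp
  have epos: "0 < e y" if "y \<in> {a..d'}" for y
    using that d by (intro e_pos_up_to_d[OF ea]) auto
  have "\<exists>\<delta>>0. \<forall>y\<in>{a..}. dist y d' < \<delta> \<longrightarrow> dist (e y) (e d') < e d'"
    using e_continuous_on[of "{a..}"] epos[of d'] a unfolding continuous_on_iff by auto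
  then obtain \<delta>1 where \<delta>1: "0 < \<delta>1" "\<And>y. a \<le> y \<Longrightarrow> dist y d' < \<delta>1 \<Longrightarrow> dist (e y) (e d') < e d'"
    by auto
  define m where "m = d' + \<delta>1 / 2"
  have m: "d' < m" using \<delta>1 by (simp add: m_def)
  have epos': "0 < e y" if "y \<in> {a..m}" for y
  proof (cases "y \<le> d'")
    case False
    then have "dist (e y) (e d') < e d'"
      using that a \<delta>1(1) by (intro \<delta>1(2)) (auto simp: m_def dist_real_def)
    then show ?thesis by (simp add: dist_real_def)
  qed (use epos that in auto)
  have "\<exists>\<delta>>0. \<forall>y\<in>{a..m}. dist y d' < \<delta> \<longrightarrow> dist (V y) (V d') < \<bar>V d'\<bar>"
    using V_continuous_on[OF epos'] V a m unfolding continuous_on_iff by auto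
  then obtain \<delta>2 where \<delta>2: "0 < \<delta>2"
    "\<And>y. y \<in> {a..m} \<Longrightarrow> dist y d' < \<delta>2 \<Longrightarrow> dist (V y) (V d') < \<bar>V d'\<bar>"
    by auto
  define n where "n = min m (d' + \<delta>2 / 2)"
  have n: "d' < n" using m \<delta>2 by (simp add: n_def)
  have "ereal n \<le> b_level a e"
    unfolding b_level_def
  proof (rule INF_greatest)
    fix y assume y: "y \<in> {x. a \<le> x \<and> e x < 0}"
    then have "y \<notin> {a..m}" using epos'[of y] by auto
    then have "m < y" using y by auto
    moreover have "n \<le> m" by (simp add: n_def)
    ultimately show "ereal n \<le> ereal y" by simp
  qed
  moreover have "ereal n \<le> (INF y\<in>{y. a < y \<and> V y = 0}. ereal y)"
  proof (rule INF_greatest)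
    fix y assume y: "y \<in> {y. a < y \<and> V y = 0}"
    then have "d \<le> ereal y" by (intro d_le) auto
    then have "d' \<le> y" using d by simp
    show "ereal n \<le> ereal y"
    proof (rule ccontr)
      assume "\<not> ereal n \<le> ereal y"
      then have "dist (V y) (V d') < \<bar>V d'\<bar>"
        using \<open>d' \<le> y\<close> y \<delta>2(1) by (intro \<delta>2(2)) (auto simp: n_def dist_real_def min_def split: if_splits)
      then show False using y by (auto simp: dist_real_def)
    qed
  qed
  ultimately have "ereal n \<le> d" unfolding d_level_def by simp
  then show False using n d by simp
qed

lemma a_less_d:
  assumes "0 < e a"
  shows "ereal a < d"
proof (rule ccontr)
  assume "\<not> ereal a < d"
  then have "d = ereal a" using a_le_d by simp
  then show False using V_d_eq_0[OF assms] V_start rho_pos by fastforce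
qed

lemma V_fun_nonneg:
  assumes "0 < e a" "a \<le> x"
  shows "0 \<le> V_fun \<mu> r \<sigma> a lam \<rho> e l x"
  using less_imp_le[OF V_pos_below_d[OF assms]] by (simp add: V_fun_def)

text \<open>\<open>\<pi>s\<close> may jump at \<open>d\<close> and then is not an admissible control; continuing its value at \<open>d\<close>
  constantly is, and above \<open>d\<close> any control is as good as any other.\<close>

lemma pi_star_admissible_extension:
  assumes ea: "0 < e a"
  obtains p where "p \<in> controls a M1" "\<And>y. a \<le> y \<Longrightarrow> ereal y < d \<Longrightarrow> p y = \<pi>s y"
proof -
  define P where "P y = (\<mu> - r) / \<sigma>\<^sup>2 * (e y / \<kappa> y)" for y
  \<comment> \<open>The set includes a finite \<open>d\<close>. On it \<open>e\<close> takes values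
    between 0 and \<open>M0\<close>, and \<open>\<kappa>\<close> is bounded away from 0.\<close>
  define A where "A = {y. a \<le> y \<and> ereal y \<le> d}"
  have P_pi: "P y = \<pi>s y" if "ereal y < d" for y
    using that by (simp add: P_def pi_star_def \<kappa>_def \<beta>_def algebra_simps)
  obtain Le where Le: "Le-lipschitz_on {a..} e" using e_lipschitz by (auto simp: lipschitz_from_def)
  obtain Ll where Ll: "Ll-lipschitz_on {a..} l" using l_lipschitz by (auto simp: lipschitz_from_def)
  define k0 where "k0 = \<beta>\<^sup>2 / 2"
  have k0: "0 < k0" using beta_pos by (simp add: k0_def)
  \<comment> \<open>The constant is read off from splitting the difference of quotients into
    \<open>(e y - e z) / \<kappa> y\<close> and
    \<open>e z * (\<kappa> z - \<kappa> y) / (\<kappa> y * \<kappa> z)\<close>.\<close>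
  define C where "C = Le / k0 + M0 * Ll / (k0 * k0)"
  have M0: "0 < M0" using ea e_le[of a] by simp
  have "C-lipschitz_on A (\<lambda>y. e y / \<kappa> y)"
  proof (rule lipschitz_onI)
    fix y z assume yz: "y \<in> A" "z \<in> A"
    have e: "0 < e z" "e z \<le> M0" using yz e_pos_up_to_d[OF ea] e_le by (auto simp: A_def)
    have k: "k0 \<le> \<kappa> y" "k0 \<le> \<kappa> z" using yz kappa_ge by (auto simp: A_def k0_def)
    have "\<bar>e y - e z\<bar> \<le> Le * \<bar>y - z\<bar>" "\<bar>\<kappa> z - \<kappa> y\<bar> \<le> Ll * \<bar>y - z\<bar>"
      using lipschitz_onD[OF Le, of y z] lipschitz_onD[OF Ll, of y z] yz
      by (auto simp: A_def dist_real_def \<kappa>_def)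
    then have "\<bar>e y - e z\<bar> / \<kappa> y \<le> Le * \<bar>y - z\<bar> / k0"
      "e z * \<bar>\<kappa> z - \<kappa> y\<bar> / (\<kappa> y * \<kappa> z) \<le> M0 * (Ll * \<bar>y - z\<bar>) / (k0 * k0)"
      using k k0 e by (auto intro!: frac_le mult_mono)
    moreover have "e y / \<kappa> y - e z / \<kappa> z = (e y - e z) / \<kappa> y + e z * (\<kappa> z - \<kappa> y) / (\<kappa> y * \<kappa> z)"
      using k k0 by (simp add: field_simps)
    then have "\<bar>e y / \<kappa> y - e z / \<kappa> z\<bar> \<le> \<bar>e y - e z\<bar> / \<kappa> y + e z * \<bar>\<kappa> z - \<kappa> y\<bar> / (\<kappa> y * \<kappa> z)"
      using k k0 e by (auto simp: abs_mult intro: order_trans[OF abs_triangle_ineq])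
    ultimately show "dist (e y / \<kappa> y) (e z / \<kappa> z) \<le> C * dist y z"
      by (simp add: dist_real_def C_def distrib_right)
  next
    show "0 \<le> C"
      using k0 M0 lipschitz_on_nonneg[OF Le] lipschitz_on_nonneg[OF Ll] by (simp add: C_def)
  qed
  then obtain D where D: "D-lipschitz_on A P"
    unfolding P_def using lipschitz_on_cmult_real by blast
  define q where "q y = (if d = \<infinity> then y else min y (real_of_ereal d))" for y
  have dreal: "d = \<infinity> \<or> d = ereal (real_of_ereal d)"
    using a_le_d by (cases d) auto
  have q: "q y = y" if "ereal y < d" for y
    using that dreal by (cases d) (auto simp: q_def)
  have qA: "q ` {a..} \<subseteq> A"
  proof
    fix z assume "z \<in> q ` {a..}"
    then show "z \<in> A" using a_le_d by (cases d) (auto simp: q_def A_def)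
  qed
  have "1-lipschitz_on {a..} q"
    by (rule lipschitz_onI) (auto simp: q_def dist_real_def)
  then have "lipschitz_from a (\<lambda>y. P (q y))"
    unfolding lipschitz_from_def
    using lipschitz_on_compose2[OF _ lipschitz_on_subset[OF D qA]] by blast
  moreover have "\<bar>P y\<bar> \<le> M1" if y: "y \<in> A" for y
  proof (cases "ereal y < d")
    case True
    then show ?thesis using P_pi[OF True] pi_star_le[of y] y by (simp add: A_def)
  next
    case False
    then have dy: "d = ereal y" using y by (simp add: A_def)
    then have ay: "a < y" using a_less_d[OF ea] by simp
    \<comment> \<open>At \<open>d\<close> itself \<open>\<pi>s\<close> is 0 by definition and says
      nothing about \<open>P\<close>; the bound is carried over from below by continuity.\<close>
    have "continuous_on (closure {a..<y}) P"
      using ay dy lipschitz_on_continuous_on[OF D]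
      by (auto simp: A_def intro: continuous_on_subset)
    moreover have "\<forall>u\<in>{a..<y}. norm (P u) \<le> M1"
      using P_pi pi_star_le dy by auto
    moreover have "y \<in> closure {a..<y}" using ay by simp
    ultimately have "norm (P y) \<le> M1" by (rule continuous_on_closure_norm_le)
    then show ?thesis by simp
  qed
  ultimately have "(\<lambda>y. P (q y)) \<in> controls a M1"
    using qA by (auto simp: controls_def)
  then show ?thesis using P_pi q by (intro that[of "\<lambda>y. P (q y)"]) auto
qed

section \<open>The upper bound\<close>

text \<open>The running cost is nonnegative, so the part before \<open>s\<close> may be dropped.
  This permits an estimate on the final stretch of the path alone.\<close>

lemma cost_hit_le:
  assumes hit: "hit_time a \<phi> = ereal \<tau>" "\<tau> \<le> T" and s: "0 \<le> s"
    and le: "ereal c \<le> enn2ereal (\<integral>\<^sup>+ t \<in> {s..\<tau>}. ennreal (lam - l (\<phi> t) + (deriv \<psi> t)\<^sup>2 / 2) \<partial>lebesgue)"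
  shows "cost \<psi> \<phi> T \<le> ereal (\<rho> - c)"
proof -
  let ?h = "\<lambda>t. ennreal (lam - l (\<phi> t) + (deriv \<psi> t)\<^sup>2 / 2)"
  have "(\<integral>\<^sup>+ t \<in> {s..\<tau>}. ?h t \<partial>lebesgue) \<le> (\<integral>\<^sup>+ t \<in> {0..\<tau>}. ?h t \<partial>lebesgue)"
    using s by (intro nn_integral_mono) (auto simp: indicator_def)
  then have "ereal c \<le> enn2ereal (\<integral>\<^sup>+ t \<in> {0..\<tau>}. ?h t \<partial>lebesgue)"
    using le by (meson less_eq_ennreal.rep_eq order_trans)
  then have "ereal \<rho> - enn2ereal (\<integral>\<^sup>+ t \<in> {0..\<tau>}. ?h t \<partial>lebesgue) \<le> ereal \<rho> - ereal c"
    by (intro ereal_minus_mono) auto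
  then show ?thesis using path_cost_hit[OF hit] by simp
qed

text \<open>Only the values of \<open>p\<close> below \<open>d\<close> are prescribed, so the bound
  covers both the admissible extension and \<open>\<pi>s\<close> itself.\<close>

lemma worst_le_V_fun:
  assumes ea: "0 < e a" and x: "a \<le> x"
    and p: "\<And>y. a \<le> y \<Longrightarrow> ereal y < d \<Longrightarrow> p y = \<pi>s y"
  shows "worst x p \<le> ereal (V_fun \<mu> r \<sigma> a lam \<rho> e l x)"
proof (rule worst_cost_leI)
  fix \<psi> \<phi> and T :: real assume st: "state x p \<psi> \<phi>"
  let ?W = "V_fun \<mu> r \<sigma> a lam \<rho> e l x"
  have ac: "abs_cont_halfline \<phi>" and \<phi>0: "\<phi> 0 = x" using st by (auto simp: is_state_def)
  have W0: "0 \<le> ?W" using ea x by (rule V_fun_nonneg)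
  show "cost \<psi> \<phi> T \<le> ereal ?W"
  proof (cases "hit_time a \<phi> \<le> ereal T")
    case False
    then show ?thesis using path_cost_not_hit W0 by (meson ereal_less_eq(5) order_trans)
  next
    case True
    then obtain \<tau> where \<tau>: "0 \<le> \<tau>" "\<tau> \<le> T" "\<phi> \<tau> = a" "hit_time a \<phi> = ereal \<tau>"
      using hit_time_attained[OF ac] by metis
    have cont: "continuous_on {u..v} \<phi>" if "0 \<le> u" for u v
      using abs_cont_halfline_imp_continuous_on[OF ac, of v]
      by (rule continuous_on_subset) (use that in auto)
    have above: "a < \<phi> t" if "0 \<le> t" "t < \<tau>" for t
      using above_before_hit[OF ac] that \<tau>(4) \<phi>0 x by auto
    then have ge: "a \<le> \<phi> t" if "0 \<le> t" "t \<le> \<tau>" for t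
      using that \<tau>(3) by (cases "t = \<tau>") (auto simp: less_imp_le)
    \<comment> \<open>\<open>s\<close> starts the final stretch below \<open>d\<close>: the last
      time at or above \<open>d\<close>, or 0 if the path never gets there. \<open>m\<close> bounds
      the path on that stretch without exceeding \<open>d\<close>, so that \<open>V\<close> is
      \<open>C1\<close> on \<open>{a..m}\<close>.\<close>
    obtain s m where s: "0 \<le> s" "s \<le> \<tau>" and m: "a \<le> m" "ereal m \<le> d" "\<And>t. t \<in> {s..\<tau>} \<Longrightarrow> \<phi> t \<le> m"
      and below: "\<And>t. s < t \<Longrightarrow> t \<le> \<tau> \<Longrightarrow> ereal (\<phi> t) < d" and Vs: "V (\<phi> s) \<le> ?W"
    proof (cases "\<exists>t\<in>{0..\<tau>}. d \<le> ereal (\<phi> t)")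
      case True
      then obtain d' where d: "d = ereal d'" using a_le_d by (cases d) auto
      have ad: "a < d'" using a_less_d[OF ea] d by simp
      define S where "S = {0..\<tau>} \<inter> \<phi> -` {d'..}"
      have "closed S" unfolding S_def
        by (intro continuous_closed_preimage cont) auto
      moreover have "S \<noteq> {}" using True d by (auto simp: S_def)
      moreover have bdd: "bdd_above S" by (auto simp: S_def bdd_above_def)
      ultimately have "Sup S \<in> S" by (intro closed_contains_Sup)
      define s where "s = Sup S"
      have s: "0 \<le> s" "s \<le> \<tau>" "d' \<le> \<phi> s" using \<open>Sup S \<in> S\<close> by (auto simp: S_def s_def)
      have below: "\<phi> t < d'" if "s < t" "t \<le> \<tau>" for t
      proof (rule ccontr)
        assume "\<not> \<phi> t < d'"
        then have "t \<in> S" using that s by (auto simp: S_def)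
        then have "t \<le> s" unfolding s_def using bdd by (rule cSup_upper)
        then show False using that by simp
      qed
      \<comment> \<open>Closedness gives only \<open>d' \<le> \<phi> s\<close>. Equality follows
        because a later passage through \<open>d'\<close> would contradict the choice of
        \<open>s\<close>.\<close>
      obtain t where t: "s \<le> t" "t \<le> \<tau>" "\<phi> t = d'"
        using IVT2'[of \<phi> \<tau> d' s] s \<tau>(3) ad cont[OF s(1)] by auto
      then have "t = s" using below[of t] by (cases "t = s") auto
      then have \<phi>s: "\<phi> s = d'" using t by simp
      then have "V (\<phi> s) \<le> ?W" using V_d_eq_0[OF ea d] W0 by simp
      moreover have "\<phi> t \<le> d'" if "t \<in> {s..\<tau>}" for t
        using below[of t] \<phi>s that by (cases "t = s") auto
      ultimately show ?thesis using s below d ad by (intro that[of s d']) auto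
    next
      case False
      then have lt: "ereal (\<phi> t) < d" if "t \<in> {0..\<tau>}" for t using that by (auto simp: not_le)
      obtain t0 where t0: "t0 \<in> {0..\<tau>}" "\<And>t. t \<in> {0..\<tau>} \<Longrightarrow> \<phi> t \<le> \<phi> t0"
        using continuous_attains_sup[of "{0..\<tau>}" \<phi>] cont[of 0 \<tau>] \<tau>(1) by auto
      have "V (\<phi> 0) = ?W" using lt[of 0] \<tau>(1) \<phi>0 by (simp add: V_fun_def)
      then show ?thesis
        using \<tau>(1) ge[of t0] t0 lt less_imp_le[OF lt[OF t0(1)]]
        by (intro that[of 0 "\<phi> t0"]) auto
    qed
    have epos: "0 < e y" if "y \<in> {a..m}" for y
    proof (rule e_pos_up_to_d[OF ea])
      have "ereal y \<le> ereal m" using that by simp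
      then show "ereal y \<le> d" using m(2) by (rule order_trans)
    qed (use that in simp)
    let ?h = "\<lambda>t. lam - l (\<phi> t) + (deriv \<psi> t)\<^sup>2 / 2"
    have "ereal (V (\<phi> \<tau>) - V (\<phi> s)) \<le> enn2ereal (\<integral>\<^sup>+ t \<in> {s..\<tau>}. ennreal (?h t) \<partial>lebesgue)"
    proof (rule chain_increment_le_nn_integral[where F = V and \<phi> = \<phi>, OF s(2)])
      show "abs_cont_on s \<tau> \<phi>"
        using ac s \<tau>(1) by (auto simp: abs_cont_halfline_def intro: abs_cont_on_subset[of 0 \<tau>])
      show "\<phi> ` {s..\<tau>} \<subseteq> {a..m}" using ge m(3) s by auto
      show "(V has_real_derivative - (\<kappa> y / e y)) (at y within {a..m})" if "y \<in> {a..m}" for y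
        using epos that by (rule V_has_real_derivative)
      show "continuous_on {a..m} (\<lambda>y. - (\<kappa> y / e y))"
        using epos by (rule neg_kappa_div_e_continuous_on)
      have "AE t in lebesgue. 0 < t \<and> ereal t < hit_time a \<phi> \<longrightarrow> (\<phi> has_real_derivative
           (- e (\<phi> t) + (\<mu> - r) * p (\<phi> t) + \<sigma> * p (\<phi> t) * deriv \<psi> t)) (at t)"
        using st by (simp add: is_state_def)
      then show "AE t in lebesgue. s < t \<and> t < \<tau> \<longrightarrow>
          (\<exists>D. (\<phi> has_real_derivative D) (at t) \<and> - (\<kappa> (\<phi> t) / e (\<phi> t)) * D \<le> ?h t)"
      proof eventually_elim
        case (elim t)
        show ?case
        proof
          assume t: "s < t \<and> t < \<tau>"
          define v where "v = deriv \<psi> t"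
          define y where "y = \<phi> t"
          have y: "a \<le> y" "ereal y < d" "0 < e y"
            using t s above[of t] below[of t] epos[of y] m(3)[of t] by (auto simp: y_def)
          have py: "p y = \<beta> * e y / (\<sigma> * \<kappa> y)"
            using p[OF y(1,2)] y(2) sigma_pos
            by (simp add: pi_star_def \<kappa>_def \<beta>_def power2_eq_square add_diff_eq diff_add_eq)
          have der: "(\<phi> has_real_derivative (- e y + (\<mu> - r) * p y + \<sigma> * p y * v)) (at t)"
            using elim t s \<tau>(4) by (simp add: y_def v_def)
          have mr: "\<mu> - r = \<beta> * \<sigma>" using sigma_pos by (simp add: \<beta>_def)
          have "- (\<kappa> y / e y) * (- e y + (\<mu> - r) * p y + \<sigma> * p y * v) = \<kappa> y - \<beta>\<^sup>2 - \<beta> * v"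
            unfolding mr py
            using y(3) sigma_pos kappa_pos[OF y(1)] by (simp add: field_simps power2_eq_square)
          \<comment> \<open>Completing the square: the loss \<open>(v + \<beta>)\<^sup>2 / 2\<close>
            vanishes exactly for the maximizer's slope \<open>- \<beta>\<close>.\<close>
          also have "\<dots> = lam - l y + v\<^sup>2 / 2 - (v + \<beta>)\<^sup>2 / 2"
            by (simp add: \<kappa>_def power2_eq_square algebra_simps add_divide_distrib diff_divide_distrib)
          also have "\<dots> \<le> lam - l y + v\<^sup>2 / 2" by simp
          finally show "\<exists>D. (\<phi> has_real_derivative D) (at t) \<and> - (\<kappa> (\<phi> t) / e (\<phi> t)) * D \<le> ?h t"
            using der by (auto simp: y_def v_def)
        qed
      qed
    qed
    then have "cost \<psi> \<phi> T \<le> ereal (\<rho> - (\<rho> - V (\<phi> s)))"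
      by (intro cost_hit_le[OF \<tau>(4,2) s(1)]) (simp add: \<tau>(3) V_start)
    also have "\<dots> \<le> ereal ?W" using Vs by simp
    finally show ?thesis .
  qed
qed

text \<open>If \<open>e a \<le> 0\<close> and the control vanishes linearly at \<open>a\<close>, then the derivative of
  \<open>ln (\<phi> - a)\<close> is bounded below by a multiple of the running cost, so \<open>a\<close> cannot be reached at
  finite cost.\<close>

lemma worst_le_zero:
  assumes ea: "e a \<le> 0" and x: "a < x" and K: "0 \<le> K" and p: "\<And>y. a \<le> y \<Longrightarrow> \<bar>p y\<bar> \<le> K * (y - a)"
  shows "worst x p \<le> 0"
proof (rule worst_cost_leI)
  fix \<psi> \<phi> and T :: real assume st: "state x p \<psi> \<phi>"
  have ac: "abs_cont_halfline \<phi>" and \<phi>0: "\<phi> 0 = x" using st by (auto simp: is_state_def)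
  obtain L where L: "L-lipschitz_on {a..} e" using e_lipschitz by (auto simp: lipschitz_from_def)
  have L0: "0 \<le> L" using L by (rule lipschitz_on_nonneg)
  have eL: "e y \<le> L * (y - a)" if "a \<le> y" for y
    using lipschitz_onD[OF L, of y a] that ea by (auto simp: dist_real_def)
  show "cost \<psi> \<phi> T \<le> 0"
  proof (cases "hit_time a \<phi> \<le> ereal T")
    case False
    then show ?thesis by (rule path_cost_not_hit)
  next
    case True
    then obtain \<tau> where \<tau>: "0 \<le> \<tau>" "\<tau> \<le> T" "\<phi> \<tau> = a" "hit_time a \<phi> = ereal \<tau>"
      using hit_time_attained[OF ac] by metis
    have \<tau>0: "0 < \<tau>" using \<tau>(1,3) \<phi>0 x by (cases "\<tau> = 0") auto
    have above: "a < \<phi> t" if "0 \<le> t" "t < \<tau>" for t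
      using above_before_hit[OF ac] that \<tau>(4) \<phi>0 x by auto
    let ?h = "\<lambda>t. lam - l (\<phi> t) + (deriv \<psi> t)\<^sup>2 / 2"
    define J where "J = (\<integral>\<^sup>+ t \<in> {0..\<tau>}. ennreal (?h t) \<partial>lebesgue)"
    have cost: "cost \<psi> \<phi> T = ereal \<rho> - enn2ereal J"
      using path_cost_hit[OF \<tau>(4,2)] by (simp add: J_def)
    have "J = \<infinity>"
    proof (rule ccontr)
      assume "J \<noteq> \<infinity>"
      then obtain j where j: "J = ennreal j" "0 \<le> j" by (cases J) auto
      \<comment> \<open>\<open>A + B * \<bar>v\<bar>\<close> will bound the speed of approach to
        \<open>a\<close> relative to the distance from \<open>a\<close>.\<close>
      define A where "A = L + (\<mu> - r) * K"
      define B where "B = \<sigma> * K"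
      define c where "c = lam - l a"
      \<comment> \<open>With \<open>C\<close>, the running cost dominates
        \<open>A + B * \<bar>v\<bar>\<close>: the constant part is absorbed by \<open>c\<close>, a
        lower bound of \<open>lam - l\<close> by monotonicity of \<open>l\<close>, and the linear
        part by the quadratic term.\<close>
      define C where "C = (A + B) / c + B + 1"
      have AB: "0 \<le> A" "0 \<le> B" using L0 K r_less sigma_pos by (auto simp: A_def B_def)
      have c: "0 < c" using l_less[of a] by (simp add: c_def)
      have C: "0 < C" using AB c by (simp add: C_def add_nonneg_pos)
      have h_ge: "A + B * \<bar>v\<bar> \<le> C * (lam - l y + v\<^sup>2 / 2)" if y: "a \<le> y" for y v
      proof -
        have "0 \<le> (\<bar>v\<bar> - 1)\<^sup>2" by simp
        then have "\<bar>v\<bar> \<le> 1 + v\<^sup>2 / 2" by (simp add: power2_eq_square algebra_simps)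
        then have "A + B * \<bar>v\<bar> \<le> A + B * (1 + v\<^sup>2 / 2)" using AB by (intro add_left_mono mult_left_mono)
        also have "\<dots> = (A + B) / c * c + B * (v\<^sup>2 / 2)" using c by (simp add: distrib_left)
        also have "\<dots> \<le> C * c + C * (v\<^sup>2 / 2)"
          using AB c by (intro add_mono mult_right_mono) (auto simp: C_def)
        also have "\<dots> = C * (c + v\<^sup>2 / 2)" by (simp add: algebra_simps)
        also have "l y \<le> l a" using monotone_onD[OF l_antimono, of a y] y by auto
        then have "C * (c + v\<^sup>2 / 2) \<le> C * (lam - l y + v\<^sup>2 / 2)"
          using C by (intro mult_left_mono) (auto simp: c_def)
        finally show ?thesis .
      qed
      \<comment> \<open>A logarithmic barrier, infinite at \<open>a\<close>, scaled so that along
        the path it grows no faster than the running cost. A total cost \<open>j\<close> then keeps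
        the path at distance at least \<open>q\<close> from \<open>a\<close>, which continuity at
        \<tau> forbids.\<close>
      define F where "F y = - (1 / C) * ln (y - a)" for y
      define q where "q = exp (ln (x - a) - C * j)"
      have far: "q \<le> \<phi> t - a" if t: "0 \<le> t" "t < \<tau>" for t
      proof -
        have cont: "continuous_on {0..t} \<phi>" by (rule abs_cont_halfline_imp_continuous_on[OF ac])
        \<comment> \<open>Before \<tau> the path stays in a compact interval strictly above
          \<open>a\<close>, where the barrier is smooth.\<close>
        obtain t0 where t0: "t0 \<in> {0..t}" "\<forall>u\<in>{0..t}. \<phi> t0 \<le> \<phi> u"
          using continuous_attains_inf[of "{0..t}" \<phi>] cont t(1) by auto
        obtain t1 where t1: "t1 \<in> {0..t}" "\<forall>u\<in>{0..t}. \<phi> u \<le> \<phi> t1"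
          using continuous_attains_sup[of "{0..t}" \<phi>] cont t(1) by auto
        have a0: "a < \<phi> t0" using above[of t0] t0(1) t by auto
        have "ereal (F (\<phi> t) - F (\<phi> 0)) \<le> enn2ereal (\<integral>\<^sup>+ u \<in> {0..t}. ennreal (?h u) \<partial>lebesgue)"
        proof (rule chain_increment_le_nn_integral[where F = F and \<phi> = \<phi>, OF t(1)])
          show "abs_cont_on 0 t \<phi>" using ac t by (auto simp: abs_cont_halfline_def)
          show "\<phi> ` {0..t} \<subseteq> {\<phi> t0..\<phi> t1}" using t0(2) t1(2) by auto
          show "(F has_real_derivative - (1 / C) / (y - a)) (at y within {\<phi> t0..\<phi> t1})"
            if "y \<in> {\<phi> t0..\<phi> t1}" for y
            unfolding F_def using that a0 C by (auto intro!: derivative_eq_intros)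
          show "continuous_on {\<phi> t0..\<phi> t1} (\<lambda>y. - (1 / C) / (y - a))"
            using a0 by (intro continuous_intros) auto
          have "AE u in lebesgue. 0 < u \<and> ereal u < hit_time a \<phi> \<longrightarrow> (\<phi> has_real_derivative
               (- e (\<phi> u) + (\<mu> - r) * p (\<phi> u) + \<sigma> * p (\<phi> u) * deriv \<psi> u)) (at u)"
            using st by (simp add: is_state_def)
          then show "AE u in lebesgue. 0 < u \<and> u < t \<longrightarrow>
              (\<exists>D. (\<phi> has_real_derivative D) (at u) \<and> - (1 / C) / (\<phi> u - a) * D \<le> ?h u)"
          proof eventually_elim
            case (elim u)
            show ?case
            proof
              assume u: "0 < u \<and> u < t"
              define v where "v = deriv \<psi> u"
              define y where "y = \<phi> u"
              have y: "a < y" using above[of u] u t by (simp add: y_def)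
              define D where "D = - e y + (\<mu> - r) * p y + \<sigma> * p y * v"
              have der: "(\<phi> has_real_derivative D) (at u)"
                using elim u t \<tau>(4) by (simp add: y_def v_def D_def)
              have py: "\<bar>p y\<bar> \<le> K * (y - a)" using p y by simp
              have "\<bar>(\<mu> - r) * p y\<bar> \<le> (\<mu> - r) * (K * (y - a))"
                using py r_less by (simp add: abs_mult)
              moreover have "\<bar>\<sigma> * p y * v\<bar> \<le> \<sigma> * (K * (y - a)) * \<bar>v\<bar>"
                using py sigma_pos by (simp add: abs_mult mult_right_mono)
              moreover have "e y \<le> L * (y - a)" using eL y by simp
              ultimately have "- D \<le> (y - a) * (A + B * \<bar>v\<bar>)"
                unfolding D_def A_def B_def by (simp add: algebra_simps abs_le_iff)
              also have "\<dots> \<le> (y - a) * (C * (lam - l y + v\<^sup>2 / 2))"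
                using h_ge[of y v] y by (intro mult_left_mono) auto
              finally have "- (1 / C) / (y - a) * D \<le> lam - l y + v\<^sup>2 / 2"
                using y C by (simp add: field_simps)
              then show "\<exists>D. (\<phi> has_real_derivative D) (at u) \<and> - (1 / C) / (\<phi> u - a) * D \<le> ?h u"
                using der by (auto simp: y_def v_def)
            qed
          qed
        qed
        also have "\<dots> \<le> enn2ereal J"
          unfolding J_def less_eq_ennreal.rep_eq[symmetric]
          using t by (intro nn_integral_mono) (auto simp: indicator_def)
        also have "\<dots> = ereal j" using j by (simp add: enn2ereal_ennreal)
        finally have "F (\<phi> t) - F x \<le> j" using \<phi>0 by simp
        then have "ln (x - a) - C * j \<le> ln (\<phi> t - a)"
          using C by (simp add: F_def field_simps)
        then show ?thesis using above[OF t] by (simp add: q_def ln_ge_iff)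
      qed
      have q: "0 < q" by (simp add: q_def)
      have "\<exists>\<delta>>0. \<forall>t\<in>{0..\<tau>}. dist t \<tau> < \<delta> \<longrightarrow> dist (\<phi> t) (\<phi> \<tau>) < q"
        using abs_cont_halfline_imp_continuous_on[OF ac, of \<tau>] q \<tau>(1)
        unfolding continuous_on_iff by auto
      then obtain \<delta> where \<delta>: "0 < \<delta>" "\<And>t. t \<in> {0..\<tau>} \<Longrightarrow> dist t \<tau> < \<delta> \<Longrightarrow> dist (\<phi> t) (\<phi> \<tau>) < q"
        by auto
      define t where "t = max 0 (\<tau> - \<delta> / 2)"
      have t: "0 \<le> t" "t < \<tau>" "dist t \<tau> < \<delta>" using \<tau>0 \<delta>(1) by (auto simp: t_def dist_real_def)
      have "dist (\<phi> t) a < q" using \<delta>(2)[of t] t \<tau>(3) by auto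
      then show False using far[OF t(1,2)] by (simp add: dist_real_def)
    qed
    then show ?thesis using cost by simp
  qed
qed

text \<open>Below \<open>d\<close> the function \<open>e\<close> is nonnegative, and
  \<open>e a \<le> 0\<close> with the Lipschitz bound makes it at most linear in
  \<open>y - a\<close>; the denominator is bounded away from 0.\<close>

lemma pi_star_le_linear:
  assumes ea: "e a \<le> 0"
  obtains K where "0 \<le> K" "\<And>y. a \<le> y \<Longrightarrow> \<bar>\<pi>s y\<bar> \<le> K * (y - a)"
proof -
  obtain L where L: "L-lipschitz_on {a..} e" using e_lipschitz by (auto simp: lipschitz_from_def)
  have L0: "0 \<le> L" using L by (rule lipschitz_on_nonneg)
  define K where "K = (\<mu> - r) * L / (\<sigma>\<^sup>2 * (\<beta>\<^sup>2 / 2))"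
  have K0: "0 \<le> K" using L0 r_less by (simp add: K_def)
  have "\<bar>\<pi>s y\<bar> \<le> K * (y - a)" if y: "a \<le> y" for y
  proof (cases "ereal y < d")
    case True
    then have e0: "0 \<le> e y" using d_le_of_e_neg[OF y] by (meson not_le)
    have eL: "e y \<le> L * (y - a)"
      using lipschitz_onD[OF L, of y a] y ea by (auto simp: dist_real_def)
    have "\<pi>s y = (\<mu> - r) * e y / (\<sigma>\<^sup>2 * \<kappa> y)"
      using True by (simp add: pi_star_def \<kappa>_def \<beta>_def add_diff_eq diff_add_eq)
    then have "\<bar>\<pi>s y\<bar> = (\<mu> - r) * e y / (\<sigma>\<^sup>2 * \<kappa> y)"
      using e0 r_less kappa_pos[OF y] by (simp add: abs_mult)
    also have "\<dots> \<le> (\<mu> - r) * (L * (y - a)) / (\<sigma>\<^sup>2 * (\<beta>\<^sup>2 / 2))"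
      using eL e0 r_less sigma_pos beta_pos kappa_ge[OF y] by (intro frac_le mult_left_mono) auto
    also have "\<dots> = K * (y - a)" by (simp add: K_def)
    finally show ?thesis .
  next
    case False
    then show ?thesis using K0 y by (simp add: pi_star_def)
  qed
  with K0 show ?thesis by (rule that)
qed

section \<open>The value at \<open>a\<close> and the saddle point\<close>

lemma zero_control: "(\<lambda>_. 0) \<in> controls a M1"
  using M1_pos lipschitz_on_constant[of "{a..}" "0::real"] by (auto simp: controls_def lipschitz_from_def)

text \<open>The hit occurs at time 0, so the reward is collected while the integral runs over a
  single point. The constant path is a state because the equation is imposed only before the
  hit.\<close>

lemma worst_at_a: "worst a p = ereal \<rho>"
proof (rule antisym)
  show "worst a p \<le> ereal \<rho>"
  proof (rule worst_cost_leI)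
    fix \<psi> \<phi> and T :: real
    show "cost \<psi> \<phi> T \<le> ereal \<rho>"
      using path_cost_le[of a lam \<rho> l \<psi> \<phi> T] rho_pos by simp
  qed
  have ac: "abs_cont_halfline (\<lambda>_. a)"
    unfolding abs_cont_halfline_def
    by (intro allI impI lipschitz_imp_abs_cont_on[OF lipschitz_on_constant])
  have hit: "hit_time a (\<lambda>_. a) = ereal 0" by (rule hit_time_eqI) auto
  have "state a p (\<lambda>t. - \<beta> * t) (\<lambda>_. a)"
    using ac by (auto simp: is_state_def hit)
  then have "cost (\<lambda>t. - \<beta> * t) (\<lambda>_. a) 0 \<le> worst a p"
    using linear_AC0 by (intro path_cost_le_worst_cost) auto
  moreover have "(\<integral>\<^sup>+ t \<in> {0..0}. ennreal (lam - l a + (deriv (\<lambda>t. - \<beta> * t) t)\<^sup>2 / 2) \<partial>lebesgue) = 0"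
    by (rule nn_integral_null_set) (auto intro: null_setsI)
  then have "cost (\<lambda>t. - \<beta> * t) (\<lambda>_. a) 0 = ereal \<rho>"
    using path_cost_hit[OF hit, of 0 lam \<rho> l "\<lambda>t. - \<beta> * t"] by (simp add: zero_ennreal.rep_eq)
  ultimately show "ereal \<rho> \<le> worst a p" by simp
qed

lemma game_le_worst: "p \<in> controls a M1 \<Longrightarrow> game x \<le> worst x p"
  unfolding game_value_def by (rule INF_lower)

lemma game_geI: "(\<And>p. c \<le> worst x p) \<Longrightarrow> c \<le> game x"
  unfolding game_value_def by (rule INF_greatest)

text \<open>\<open>\<pi>s\<close> need not lie in \<open>controls\<close>, so the infimum is bounded
  through the admissible extension. The lower bound holds for every feedback and therefore also
  applies to \<open>\<pi>s\<close>.\<close>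

lemma saddle_e_pos:
  assumes ea: "0 < e a" and x: "a \<le> x"
  shows "game x = ereal (V_fun \<mu> r \<sigma> a lam \<rho> e l x)" "worst x \<pi>s = game x"
proof -
  let ?W = "ereal (V_fun \<mu> r \<sigma> a lam \<rho> e l x)"
  have lower: "?W \<le> worst x p" for p
  proof (cases "ereal x < d")
    case True
    have "0 < e y" if y: "y \<in> {a..x}" for y
    proof (rule e_pos_up_to_d[OF ea])
      have "ereal y \<le> ereal x" using y by simp
      also have "\<dots> \<le> d" using True by simp
      finally show "ereal y \<le> d" .
    qed (use y in simp)
    then show ?thesis using V_le_worst[OF _ x] True by (simp add: V_fun_def)
  next
    case False
    then have "a < x" using a_less_d[OF ea] x by (cases "x = a") auto
    then show ?thesis using worst_nonneg False by (simp add: V_fun_def zero_ereal_def)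
  qed
  obtain p where p: "p \<in> controls a M1" "\<And>y. a \<le> y \<Longrightarrow> ereal y < d \<Longrightarrow> p y = \<pi>s y"
    using pi_star_admissible_extension[OF ea] by blast
  have "game x \<le> ?W"
    using game_le_worst[OF p(1)] worst_le_V_fun[OF ea x p(2)] by (rule order_trans)
  moreover have "?W \<le> game x" using lower by (rule game_geI)
  ultimately show game: "game x = ?W" by (rule antisym)
  have "worst x \<pi>s \<le> ?W" by (rule worst_le_V_fun[OF ea x refl])
  then show "worst x \<pi>s = game x" using lower[of \<pi>s] game by simp
qed

text \<open>The zero control supplies an admissible upper bound, while \<open>\<pi>s\<close> is
  treated by its own linear estimate.\<close>

lemma saddle_e_nonpos:
  assumes ea: "e a \<le> 0" and x: "a < x"
  shows "game x = 0" "worst x \<pi>s = 0"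
proof -
  have "worst x (\<lambda>_. 0) \<le> 0" by (rule worst_le_zero[OF ea x order_refl]) simp
  then have "game x \<le> 0" using game_le_worst[OF zero_control] order_trans by blast
  moreover have "0 \<le> game x" using worst_nonneg[OF x] by (rule game_geI)
  ultimately show "game x = 0" by (rule antisym)
  obtain K where "0 \<le> K" "\<And>y. a \<le> y \<Longrightarrow> \<bar>\<pi>s y\<bar> \<le> K * (y - a)"
    using pi_star_le_linear[OF ea] by blast
  then have "worst x \<pi>s \<le> 0" by (rule worst_le_zero[OF ea x])
  then show "worst x \<pi>s = 0" using worst_nonneg[OF x] by (rule antisym)
qed

lemma game_at_a: "game a = ereal \<rho>"
  using game_le_worst[OF zero_control, of a] game_geI[of "ereal \<rho>" a] by (simp add: worst_at_a)

end

text \<open>The premise of the first part marks where the formula gives the value. At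
  \<open>x = a\<close> the game is worth \<open>\<rho>\<close>, but \<open>V_fun\<close> is 0 there
  if \<open>d\<close> equals \<open>a\<close>. If \<open>e a = 0\<close> and
  \<open>a < x < d\<close>, divergence or division by zero makes the integral 0 and
  \<open>V_fun\<close> equal to \<open>\<rho>\<close>, while the game is worth 0.\<close>

theorem proposition1:
  fixes \<mu> r \<sigma> M0 M1 a lam \<rho> :: real and e l :: "real \<Rightarrow> real"
  assumes "r < \<mu>" "0 < r" "0 < \<sigma>" "0 < M0" "0 < a" "0 < lam" "0 < \<rho>"
    and "lipschitz_from a e" "\<forall>x\<ge>a. e x \<le> M0"
    and "lipschitz_from a l" "\<forall>x\<ge>a. 0 \<le> l x \<and> l x < lam" "antimono_on {a..} l"
    and "0 < M1" "\<forall>x\<ge>a. \<bar>pi_star \<mu> r \<sigma> a lam \<rho> e l x\<bar> \<le> M1"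
  shows "(\<forall>x\<ge>a. 0 < e a \<or> (a < x \<and> d_level \<mu> r \<sigma> a lam \<rho> e l \<le> ereal x) \<longrightarrow>
            game_value \<mu> r \<sigma> M1 a lam \<rho> e l x = ereal (V_fun \<mu> r \<sigma> a lam \<rho> e l x))
       \<and> (\<forall>x\<ge>a. worst_cost \<mu> r \<sigma> a lam \<rho> e l x (pi_star \<mu> r \<sigma> a lam \<rho> e l)
                 = game_value \<mu> r \<sigma> M1 a lam \<rho> e l x)"
proof -
  interpret investment_game \<mu> r \<sigma> M0 M1 a lam \<rho> e l
    using assms by unfold_locales auto
  show ?thesis
  proof (intro conjI allI impI)
    fix x assume x: "a \<le> x" and c: "0 < e a \<or> (a < x \<and> d \<le> ereal x)"
    show "game x = ereal (V_fun \<mu> r \<sigma> a lam \<rho> e l x)"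
    proof (cases "0 < e a")
      case False
      then have "a < x" "V_fun \<mu> r \<sigma> a lam \<rho> e l x = 0" using c by (auto simp: V_fun_def)
      then show ?thesis using saddle_e_nonpos(1) False by (simp add: zero_ereal_def)
    qed (rule saddle_e_pos(1)[OF _ x])
  next
    fix x assume x: "a \<le> x"
    show "worst x \<pi>s = game x"
    proof (cases "x = a")
      case True
      then show ?thesis by (simp add: worst_at_a game_at_a)
    next
      case False
      then show ?thesis
        using saddle_e_pos(2)[OF _ x] saddle_e_nonpos x by (cases "0 < e a") auto
    qed
  qed
qed

end
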